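(* Let $A^1,A^2,A^3$ be the $3$-point metric spaces whose three distances between distinct points are, respectively, $$A^1:\ 8,\ 22,\ 29.5;\qquad A^2:\ 11.5,\ 18,\ 29;\qquad A^3:\ 12,\ 21.5,\ 33,$$ and let $M=\{A^1,A^2,A^3\}\subset\mathcal{M}$. Then a Steiner minimal tree on $M$ in $\mathcal{M}$ exists, i.e. $\operatorname{SMT}(M,\mathcal{M})\neq\emptyset$, and it is not a minimal filling of $M$, i.e. $\operatorname{smt}(M,\mathcal{M})>\operatorname{mf}(M)$. Hence $\operatorname{ssr}(\mathcal{M})<1$.
   Context: $\mathcal{M}$ is the Gromov--Hausdorff space: the set of isometry classes of nonempty compact metric spaces with the Gromov--Hausdorff metric $d_{GH}$. Let $X$ be a metric space and $|xy|$ the distance between its points. A (finite) graph $G=(V,E)$ is defined on $X$ if $V\subset X$; the length of an edge $vw$ is $|vw|$, and the length $|G|$ of $G$ is the sum of the lengths of its edges. For a finite $M\subset X$, $G$ connects $M$ if $M\subset V$. The number $\operatorname{smt}(M,X)$ is the infimum of the lengths of connected graphs on $X$ that connect $M$. A Steiner minimal tree on $M$ in $X$ is a tree $G$ on $X$ that connects $M$ and satisfies $|G|=\operatorname{smt}(M,X)$; the set of all of these is $\operatorname{SMT}(M,X)$. For a finite metric space $M$, the length of minimal filling $\operatorname{mf}(M)$ is the infimum of those $r$ for which there exist a metric space $X$ and an isometric (distance-preserving) embedding $\mu\colon M\to X$ with $\operatorname{smt}(\mu(M),X)\le r$. A Steiner minimal tree $G$ on $M$ is a minimal filling of $M$ if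 $|G|=\operatorname{mf}(M)$. The Steiner subratio of a metric space $X$ is $$\operatorname{ssr}(X)=\inf\Bigl\{\frac{\operatorname{mf}(M)}{\operatorname{smt}(M,X)}: M\subset X,\ 2\le\#M<\infty\Bigr\}.$$ *)

theory Defs
  imports "HOL-Analysis.Analysis"
begin

section \<open>Isometric embeddings and the Gromov--Hausdorff distance\<close>

definition isometric_embedding :: "'a metric \<Rightarrow> 'b metric \<Rightarrow> ('a \<Rightarrow> 'b) \<Rightarrow> bool" where
  "isometric_embedding X Z f \<longleftrightarrow>
     f \<in> mspace X \<rightarrow> mspace Z \<and>
     (\<forall>x\<in>mspace X. \<forall>y\<in>mspace X. mdist Z (f x) (f y) = mdist X x y)"

definition isometric :: "'a metric \<Rightarrow> 'b metric \<Rightarrow> bool" where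
  "isometric X Y \<longleftrightarrow> (\<exists>f. isometric_embedding X Y f \<and> f ` mspace X = mspace Y)"

definition compact_metric :: "'a metric \<Rightarrow> bool" where
  "compact_metric X \<longleftrightarrow> mspace X \<noteq> {} \<and> compact_space (mtopology_of X)"

definition hausdorff_dist :: "'a metric \<Rightarrow> 'a set \<Rightarrow> 'a set \<Rightarrow> real" where
  "hausdorff_dist Z A B =
     Inf {r. 0 < r \<and> A \<subseteq> (\<Union>b\<in>B. mball_of Z b r) \<and> B \<subseteq> (\<Union>a\<in>A. mball_of Z a r)}"

text \<open>
  The ambient space Z ought to range over all metric spaces, which cannot be quantified over inside
  a formula. Carriers in \<^typ>\<open>real\<close> suffice, since compact metric spaces have at most the
  cardinality of the continuum; \<open>GH_dist_le\<close> below shows that ambient spaces over any other type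
  give nothing smaller.
\<close>

definition GH_dist :: "'a metric \<Rightarrow> 'b metric \<Rightarrow> real" where
  "GH_dist X Y =
     Inf {hausdorff_dist Z (f ` mspace X) (g ` mspace Y) | (Z :: real metric) f g.
            isometric_embedding X Z f \<and> isometric_embedding Y Z g}"

text \<open>
  Similarly, every compact metric space is isometric to one with carrier in \<^typ>\<open>real\<close>
  (\<open>isometry_class_in_GH\<close> below), so these represent all isometry classes.
\<close>

definition isometry_class :: "'a metric \<Rightarrow> real metric set" where
  "isometry_class X = {Y. compact_metric Y \<and> isometric X Y}"

definition isometry_classes :: "real metric set set" where
  "isometry_classes = isometry_class ` {X :: real metric. compact_metric X}"

text \<open>
  The default value outside the carrier is needed because \<^const>\<open>Metric_space\<close> requires
  nonnegativity and symmetry everywhere.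
\<close>

definition class_dist :: "real metric set \<Rightarrow> real metric set \<Rightarrow> real" where
  "class_dist C D =
     (if C \<in> isometry_classes \<and> D \<in> isometry_classes
      then GH_dist (SOME X. X \<in> C) (SOME Y. Y \<in> D) else 0)"

definition GH_space :: "real metric set metric" where
  "GH_space = metric (isometry_classes, class_dist)"


section \<open>Graphs on metric spaces, Steiner minimal trees and minimal fillings\<close>

text \<open>A graph is a pair of its vertex set and its set of edges, which are two-element sets.\<close>

type_synonym 'a graph = "'a set \<times> 'a set set"

definition graph_on :: "'a metric \<Rightarrow> 'a graph \<Rightarrow> bool" where
  "graph_on X G \<longleftrightarrow>
     finite (fst G) \<and> fst G \<subseteq> mspace X \<and>
     snd G \<subseteq> {{v, w} | v w. v \<in> fst G \<and> w \<in> fst G \<and> v \<noteq> w}"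

definition edge_length :: "'a metric \<Rightarrow> 'a set \<Rightarrow> real" where
  "edge_length X e = (THE l. \<exists>v w. e = {v, w} \<and> l = mdist X v w)"

definition graph_length :: "'a metric \<Rightarrow> 'a graph \<Rightarrow> real" where
  "graph_length X G = (\<Sum>e\<in>snd G. edge_length X e)"

definition connected_graph :: "'a graph \<Rightarrow> bool" where
  "connected_graph G \<longleftrightarrow>
     (\<forall>v\<in>fst G. \<forall>w\<in>fst G. (v, w) \<in> {(x, y). {x, y} \<in> snd G}\<^sup>*)"

definition graph_cycle :: "'a graph \<Rightarrow> 'a list \<Rightarrow> bool" where
  "graph_cycle G vs \<longleftrightarrow>
     3 \<le> length vs \<and> distinct vs \<and>
     (\<forall>i<length vs. {vs ! i, vs ! (Suc i mod length vs)} \<in> snd G)"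

definition tree_graph :: "'a graph \<Rightarrow> bool" where
  "tree_graph G \<longleftrightarrow> connected_graph G \<and> \<not> (\<exists>vs. graph_cycle G vs)"

definition smt :: "'a set \<Rightarrow> 'a metric \<Rightarrow> real" where
  "smt M X = Inf {graph_length X G | G. graph_on X G \<and> connected_graph G \<and> M \<subseteq> fst G}"

definition SMT :: "'a set \<Rightarrow> 'a metric \<Rightarrow> 'a graph set" where
  "SMT M X =
     {G. graph_on X G \<and> tree_graph G \<and> M \<subseteq> fst G \<and> graph_length X G = smt M X}"

text \<open>
  Again the ambient space X would range over all metric spaces. As M is finite and the graphs are
  finite, any infinite carrier type yields the same infimum; see \<open>mf_le\<close> below.
\<close>

definition mf :: "'a metric \<Rightarrow> real" where
  "mf M = Inf {r. \<exists>(X :: real metric) \<mu>.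
                 isometric_embedding M X \<mu> \<and> smt (\<mu> ` mspace M) X \<le> r}"

definition minimal_filling :: "'a graph \<Rightarrow> 'a set \<Rightarrow> 'a metric \<Rightarrow> bool" where
  "minimal_filling G M X \<longleftrightarrow> G \<in> SMT M X \<and> graph_length X G = mf (submetric X M)"

definition ssr :: "'a metric \<Rightarrow> real" where
  "ssr X = Inf {mf (submetric X M) / smt M X | M. M \<subseteq> mspace X \<and> finite M \<and> 2 \<le> card M}"


section \<open>Three-point spaces\<close>

definition three_point_dist :: "real \<Rightarrow> real \<Rightarrow> real \<Rightarrow> nat \<Rightarrow> nat \<Rightarrow> real" where
  "three_point_dist a b c i j =
     (if {i, j} = {0, 1} then a else if {i, j} = {0, 2} then b else if {i, j} = {1, 2} then c
      else 0)"

text \<open>This is meaningful when a, b, c are positive and satisfy the triangle inequalities.\<close>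

definition three_point_space :: "real \<Rightarrow> real \<Rightarrow> real \<Rightarrow> nat metric" where
  "three_point_space a b c = metric ({0, 1, 2}, three_point_dist a b c)"


section \<open>Adequacy of the definitions\<close>

subsection \<open>Three-point spaces\<close>

lemma Metric_space_three_point:
  assumes "0 < a" "0 < b" "0 < c" "a \<le> b + c" "b \<le> a + c" "c \<le> a + b"
  shows "Metric_space {0, 1, 2} (three_point_dist a b c)"
  using assms by unfold_locales (auto simp: three_point_dist_def doubleton_eq_iff)

lemma three_point_space_simps:
  assumes "0 < a" "0 < b" "0 < c" "a \<le> b + c" "b \<le> a + c" "c \<le> a + b"
  shows "mspace (three_point_space a b c) = {0, 1, 2}"
    and "mdist (three_point_space a b c) = three_point_dist a b c"
  using Metric_space.mspace_metric[OF Metric_space_three_point[OF assms]]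
        Metric_space.mdist_metric[OF Metric_space_three_point[OF assms]]
  by (simp_all add: three_point_space_def)

lemma compact_metric_finite:
  assumes "finite (mspace X)" "mspace X \<noteq> {}"
  shows "compact_metric X"
  using assms by (simp add: compact_metric_def compact_space_def finite_imp_compactin_eq)

lemma compact_metric_three_point:
  assumes "0 < a" "0 < b" "0 < c" "a \<le> b + c" "b \<le> a + c" "c \<le> a + b"
  shows "compact_metric (three_point_space a b c)"
  by (rule compact_metric_finite) (simp_all add: three_point_space_simps[OF assms])


subsection \<open>Transport of metrics along injections\<close>

lemma isometric_embedding_inj:
  "isometric_embedding X Z f \<Longrightarrow> inj_on f (mspace X)"
  unfolding isometric_embedding_def inj_on_def
  by (metis mdist_zero)

lemma isometric_embedding_comp:
  "isometric_embedding X Y f \<Longrightarrow> isometric_embedding Y Z g \<Longrightarrow> isometric_embedding X Z (g \<circ> f)"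
  unfolding isometric_embedding_def by (auto simp: Pi_iff)

lemma transport_metric:
  fixes X :: "'a metric" and h :: "'a \<Rightarrow> 'b"
  assumes "inj_on h (mspace X)"
  obtains Y :: "'b metric" where "mspace Y = h ` mspace X" "isometric_embedding X Y h"
proof -
  let ?d = "\<lambda>u v. mdist X (inv_into (mspace X) h u) (inv_into (mspace X) h v)"
  have M: "Metric_space (h ` mspace X) ?d"
  proof
    fix x y z assume "x \<in> h ` mspace X" "y \<in> h ` mspace X" "z \<in> h ` mspace X"
    then show "?d x z \<le> ?d x y + ?d y z"
      by (intro mdist_triangle inv_into_into)
  next
    fix x y assume "x \<in> h ` mspace X" "y \<in> h ` mspace X"
    then show "?d x y = 0 \<longleftrightarrow> x = y"
      by (simp add: inv_into_into) (metis f_inv_into_f)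
  qed (simp_all add: mdist_commute)
  show thesis
  proof (rule that[of "metric (h ` mspace X, ?d)"])
    show "mspace (metric (h ` mspace X, ?d)) = h ` mspace X"
      by (rule Metric_space.mspace_metric[OF M])
    show "isometric_embedding X (metric (h ` mspace X, ?d)) h"
      unfolding isometric_embedding_def
      using assms by (auto simp: Metric_space.mspace_metric[OF M] Metric_space.mdist_metric[OF M])
  qed
qed

lemma compact_metric_mbounded:
  assumes "compact_metric X"
  shows "\<exists>B. \<forall>x\<in>mspace X. \<forall>y\<in>mspace X. mdist X x y \<le> B"
proof -
  interpret Metric_space "mspace X" "mdist X" by simp
  have "compactin mtopology (mspace X)"
    using assms by (simp add: compact_metric_def compact_space_def mtopology_of_def)
  from compactin_imp_mbounded[OF this] show ?thesis
    by (simp add: mbounded_alt)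
qed

lemma compact_metric_inj_real:
  fixes X :: "'a metric"
  assumes "compact_metric X"
  obtains h :: "'a \<Rightarrow> real" where "inj_on h (mspace X)"
proof -
  interpret Metric_space "mspace X" "mdist X" by simp
  have "compactin mtopology (mspace X)"
    using assms by (simp add: compact_metric_def compact_space_def mtopology_of_def)
  then have tb: "mtotally_bounded (mspace X)"
    by (rule compactin_imp_mtotally_bounded)
  have "\<forall>n. \<exists>K. finite K \<and> K \<subseteq> mspace X \<and> mspace X \<subseteq> (\<Union>x\<in>K. mball x (inverse (Suc n)))"
    using tb unfolding mtotally_bounded_def by (metis inverse_positive_iff_positive of_nat_0_less_iff zero_less_Suc)
  then obtain K where K: "\<And>n. finite (K n)" "\<And>n. K n \<subseteq> mspace X"
      "\<And>n::nat. mspace X \<subseteq> (\<Union>x\<in>K n. mball x (inverse (Suc n)))"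
    by metis
  define D where "D = (\<Union>n. K n)"
  have cD: "countable D"
    unfolding D_def using K(1) by (simp add: countable_finite)
  define s where "s x = {prod_encode (to_nat_on D c, n) |c n. c \<in> D \<and> mdist X x c < inverse (real (Suc n))}" for x
  have inj: "inj_on s (mspace X)"
  proof (rule inj_onI, rule ccontr)
    fix x y assume xy: "x \<in> mspace X" "y \<in> mspace X" "s x = s y" "x \<noteq> y"
    then have "mdist X x y > 0" by simp
    then obtain n where n: "inverse (real (Suc n)) < mdist X x y / 2"
      using reals_Archimedean[of "mdist X x y / 2"] by auto
    obtain c where c: "c \<in> K n" "mdist X c x < inverse (Suc n)"
      using K(3)[of n] xy(1) by auto
    then have "c \<in> D" by (auto simp: D_def)
    moreover have cx: "mdist X x c < inverse (Suc n)" using c by (simp add: commute)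
    ultimately have "prod_encode (to_nat_on D c, n) \<in> s x" unfolding s_def by blast
    then have "prod_encode (to_nat_on D c, n) \<in> s y" using xy by simp
    then obtain c' where "c' \<in> D" "to_nat_on D c = to_nat_on D c'" "mdist X y c' < inverse (Suc n)"
      unfolding s_def by auto
    with cD \<open>c \<in> D\<close> have "mdist X y c < inverse (Suc n)" by auto
    moreover have "mdist X x y \<le> mdist X x c + mdist X y c"
      using xy c K(2) by (metis commute subsetD triangle)
    ultimately show False using cx n by simp
  qed
  obtain b :: "nat set \<Rightarrow> real" where "bij_betw b UNIV UNIV"
    using nat_sets_eqpoll_reals unfolding eqpoll_def by blast
  then have "inj_on (b \<circ> s) (mspace X)"
    using inj by (metis bij_betw_def comp_inj_on inj_on_subset subset_UNIV)
  then show thesis by (rule that)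
qed

lemma compact_metric_isometric:
  assumes "compact_metric X" "isometric_embedding X Y f" "f ` mspace X = mspace Y"
  shows "compact_metric Y"
proof -
  interpret Metric_space12 "mspace X" "mdist X" "mspace Y" "mdist Y"
    by (simp add: Metric_space12_def)
  have "homeomorphic_map M1.mtopology M2.mtopology f"
    by (rule isometry_imp_homeomorphic_map) (use assms in \<open>auto simp: isometric_embedding_def\<close>)
  then have "M1.mtopology homeomorphic_space M2.mtopology"
    using homeomorphic_map_imp_homeomorphic_space by blast
  then have "compact_space M1.mtopology \<longleftrightarrow> compact_space M2.mtopology"
    by (rule homeomorphic_compact_space)
  then show ?thesis using assms by (auto simp: compact_metric_def mtopology_of_def)
qed

lemma isometric_refl: "isometric X X"
  unfolding isometric_def isometric_embedding_def by (rule exI[of _ id]) auto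

lemma isometric_sym:
  assumes "isometric X Y"
  shows "isometric Y X"
proof -
  obtain f where f: "isometric_embedding X Y f" "f ` mspace X = mspace Y"
    using assms by (auto simp: isometric_def)
  let ?g = "inv_into (mspace X) f"
  have i: "inj_on f (mspace X)" using isometric_embedding_inj f by blast
  have gi: "?g y \<in> mspace X" "f (?g y) = y" if "y \<in> mspace Y" for y
    using that f(2) by (metis inv_into_into, metis f_inv_into_f)
  have "isometric_embedding Y X ?g"
    unfolding isometric_embedding_def
  proof (intro conjI ballI)
    show "?g \<in> mspace Y \<rightarrow> mspace X" using gi by auto
    fix x y assume "x \<in> mspace Y" "y \<in> mspace Y"
    then show "mdist X (?g x) (?g y) = mdist Y x y"
      using f(1) gi unfolding isometric_embedding_def by metis
  qed
  moreover have "?g ` mspace Y = mspace X"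
    using f(2) i by (metis inv_into_image_cancel subset_refl)
  ultimately show ?thesis by (auto simp: isometric_def)
qed

lemma isometric_trans:
  assumes "isometric X Y" "isometric Y Z"
  shows "isometric X Z"
proof -
  obtain f g where "isometric_embedding X Y f" "f ` mspace X = mspace Y"
      "isometric_embedding Y Z g" "g ` mspace Y = mspace Z"
    using assms by (auto simp: isometric_def)
  then have "isometric_embedding X Z (g \<circ> f)" "(g \<circ> f) ` mspace X = mspace Z"
    using isometric_embedding_comp by (blast, metis image_comp)
  then show ?thesis unfolding isometric_def by blast
qed

lemma isometric_real_exists:
  assumes "compact_metric X"
  obtains Y :: "real metric" where "compact_metric Y" "isometric X Y"
proof -
  obtain h :: "'a \<Rightarrow> real" where h: "inj_on h (mspace X)"
    using compact_metric_inj_real[OF assms] by blast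
  obtain Y :: "real metric" where Y: "mspace Y = h ` mspace X" "isometric_embedding X Y h"
    using transport_metric[OF h] by blast
  have "isometric X Y" unfolding isometric_def using Y by metis
  then show thesis using that compact_metric_isometric[OF assms Y(2) Y(1)[symmetric]] by blast
qed

lemma isometry_class_eq_iff:
  fixes X :: "'a metric" and Y :: "'b metric"
  assumes "compact_metric X" "compact_metric Y"
  shows "isometry_class X = isometry_class Y \<longleftrightarrow> isometric X Y"
proof
  assume eq: "isometry_class X = isometry_class Y"
  obtain W :: "real metric" where "compact_metric W" "isometric X W"
    using isometric_real_exists[OF assms(1)] .
  then have "isometric X W" "isometric Y W" using eq by (auto simp: isometry_class_def)
  then show "isometric X Y" using isometric_trans[OF _ isometric_sym] by blast
next
  assume "isometric X Y"
  then have "isometric X W \<longleftrightarrow> isometric Y W" for W :: "real metric"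
    using isometric_trans[of X Y W] isometric_trans[OF isometric_sym, of X Y W] by blast
  then show "isometry_class X = isometry_class Y"
    unfolding isometry_class_def by simp
qed

lemma isometry_class_in_classes:
  fixes X :: "'a metric"
  assumes "compact_metric X"
  shows "isometry_class X \<in> isometry_classes"
proof -
  obtain W :: "real metric" where "compact_metric W" "isometric X W"
    using isometric_real_exists[OF assms(1)] .
  then show ?thesis
    unfolding isometry_classes_def using isometry_class_eq_iff[OF assms \<open>compact_metric W\<close>] by blast
qed


subsection \<open>Gromov--Hausdorff distance and correspondences\<close>

definition correspondence :: "'a metric \<Rightarrow> 'b metric \<Rightarrow> ('a \<times> 'b) set \<Rightarrow> real \<Rightarrow> bool" where
  "correspondence X Y R e \<longleftrightarrow>
     fst ` R = mspace X \<and> snd ` R = mspace Y \<and>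
     (\<forall>(x, y)\<in>R. \<forall>(x', y')\<in>R. \<bar>mdist X x x' - mdist Y y y'\<bar> \<le> e)"

lemma correspondenceD:
  assumes "correspondence X Y R e"
  shows "(x, y) \<in> R \<Longrightarrow> x \<in> mspace X" "(x, y) \<in> R \<Longrightarrow> y \<in> mspace Y"
    "x \<in> mspace X \<Longrightarrow> \<exists>y. (x, y) \<in> R" "y \<in> mspace Y \<Longrightarrow> \<exists>x. (x, y) \<in> R"
    "(x, y) \<in> R \<Longrightarrow> (x', y') \<in> R \<Longrightarrow> \<bar>mdist X x x' - mdist Y y y'\<bar> \<le> e"
proof -
  have fs: "fst ` R = mspace X" "snd ` R = mspace Y"
    and d: "\<forall>(x, y)\<in>R. \<forall>(x', y')\<in>R. \<bar>mdist X x x' - mdist Y y y'\<bar> \<le> e"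
    using assms by (simp_all add: correspondence_def)
  show "(x, y) \<in> R \<Longrightarrow> x \<in> mspace X" "(x, y) \<in> R \<Longrightarrow> y \<in> mspace Y"
    unfolding fs[symmetric] by force+
  show "x \<in> mspace X \<Longrightarrow> \<exists>y. (x, y) \<in> R" "y \<in> mspace Y \<Longrightarrow> \<exists>x. (x, y) \<in> R"
    unfolding fs[symmetric] by auto
  show "(x, y) \<in> R \<Longrightarrow> (x', y') \<in> R \<Longrightarrow> \<bar>mdist X x x' - mdist Y y y'\<bar> \<le> e"
    using d by blast
qed

lemma correspondenceI:
  assumes "\<And>x y. (x, y) \<in> R \<Longrightarrow> x \<in> mspace X \<and> y \<in> mspace Y"
    "\<And>x. x \<in> mspace X \<Longrightarrow> \<exists>y. (x, y) \<in> R" "\<And>y. y \<in> mspace Y \<Longrightarrow> \<exists>x. (x, y) \<in> R"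
    "\<And>x y x' y'. (x, y) \<in> R \<Longrightarrow> (x', y') \<in> R \<Longrightarrow> \<bar>mdist X x x' - mdist Y y y'\<bar> \<le> e"
  shows "correspondence X Y R e"
  unfolding correspondence_def
proof (intro conjI)
  show "fst ` R = mspace X" "snd ` R = mspace Y" using assms(1-3) by (auto simp: image_iff Bex_def)
  show "\<forall>(x, y)\<in>R. \<forall>(x', y')\<in>R. \<bar>mdist X x x' - mdist Y y y'\<bar> \<le> e" using assms(4) by blast
qed

lemma correspondence_converse:
  "correspondence X Y R e \<Longrightarrow> correspondence Y X (R\<inverse>) e"
  by (rule correspondenceI) (auto dest: correspondenceD simp: abs_minus_commute)

lemma correspondence_comp:
  assumes R: "correspondence X Y R e" and S: "correspondence Y Z S e'"
  shows "correspondence X Z (R O S) (e + e')"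
proof (rule correspondenceI)
  fix x z x' z' assume "(x, z) \<in> R O S" "(x', z') \<in> R O S"
  then obtain y y' where "(x, y) \<in> R" "(y, z) \<in> S" "(x', y') \<in> R" "(y', z') \<in> S" by auto
  then show "\<bar>mdist X x x' - mdist Z z z'\<bar> \<le> e + e'"
    using correspondenceD(5)[OF R, of x y x' y'] correspondenceD(5)[OF S, of y z y' z'] by linarith
next
  fix x z assume "(x, z) \<in> R O S"
  then show "x \<in> mspace X \<and> z \<in> mspace Z"
    using correspondenceD(1)[OF R] correspondenceD(2)[OF S] by blast
next
  fix x assume "x \<in> mspace X"
  then show "\<exists>z. (x, z) \<in> R O S"
    using correspondenceD(2,3)[OF R] correspondenceD(3)[OF S] by blast
next
  fix z assume "z \<in> mspace Z"
  then show "\<exists>x. (x, z) \<in> R O S"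
    using correspondenceD(4)[OF R] correspondenceD(1,4)[OF S] by blast
qed

lemma hausdorff_dist_le:
  assumes "0 < r" "\<And>a. a \<in> A \<Longrightarrow> \<exists>b\<in>B. mdist Z a b < r" "\<And>b. b \<in> B \<Longrightarrow> \<exists>a\<in>A. mdist Z a b < r"
    "A \<subseteq> mspace Z" "B \<subseteq> mspace Z"
  shows "hausdorff_dist Z A B \<le> r"
  unfolding hausdorff_dist_def
proof (rule cInf_lower)
  have "A \<subseteq> (\<Union>b\<in>B. mball_of Z b r)"
    using assms by (auto simp: mdist_commute) (metis mdist_commute subsetD)
  moreover have "B \<subseteq> (\<Union>a\<in>A. mball_of Z a r)"
    using assms by auto (metis subsetD)
  ultimately show "r \<in> {r. 0 < r \<and> A \<subseteq> (\<Union>b\<in>B. mball_of Z b r) \<and> B \<subseteq> (\<Union>a\<in>A. mball_of Z a r)}"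
    using assms by blast
qed (auto intro: bdd_belowI[of _ 0])

lemma hausdorff_set_nonempty:
  assumes "compact_metric X" "compact_metric Y"
    "isometric_embedding X Z f" "isometric_embedding Y Z g"
  shows "{r. 0 < r \<and> f ` mspace X \<subseteq> (\<Union>b\<in>g ` mspace Y. mball_of Z b r)
            \<and> g ` mspace Y \<subseteq> (\<Union>a\<in>f ` mspace X. mball_of Z a r)} \<noteq> {}"
proof -
  obtain B where B: "\<And>x y. x \<in> mspace X \<Longrightarrow> y \<in> mspace X \<Longrightarrow> mdist X x y \<le> B"
    using compact_metric_mbounded[OF assms(1)] by blast
  obtain C where C: "\<And>x y. x \<in> mspace Y \<Longrightarrow> y \<in> mspace Y \<Longrightarrow> mdist Y x y \<le> C"
    using compact_metric_mbounded[OF assms(2)] by blast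
  obtain x0 y0 where 0: "x0 \<in> mspace X" "y0 \<in> mspace Y"
    using assms by (auto simp: compact_metric_def)
  define r where "r = B + C + mdist Z (f x0) (g y0) + 1"
  have BC: "0 \<le> B" "0 \<le> C"
    using B[OF 0(1) 0(1)] C[OF 0(2) 0(2)] mdist_nonneg[of X x0 x0] mdist_nonneg[of Y y0 y0] by linarith+
  have in_Z: "x \<in> mspace X \<Longrightarrow> f x \<in> mspace Z" "y \<in> mspace Y \<Longrightarrow> g y \<in> mspace Z" for x y
    using assms by (auto simp: isometric_embedding_def)
  have 1: "mdist Z (f x) (g y0) < r" if "x \<in> mspace X" for x
  proof -
    have "mdist Z (f x) (g y0) \<le> mdist Z (f x) (f x0) + mdist Z (f x0) (g y0)"
      by (intro mdist_triangle in_Z 0 that)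
    moreover have "mdist Z (f x) (f x0) \<le> B"
      using assms(3) that 0 B by (simp add: isometric_embedding_def)
    ultimately show ?thesis using BC by (simp add: r_def)
  qed
  have 2: "mdist Z (f x0) (g y) < r" if "y \<in> mspace Y" for y
  proof -
    have "mdist Z (f x0) (g y) \<le> mdist Z (f x0) (g y0) + mdist Z (g y0) (g y)"
      by (intro mdist_triangle in_Z 0 that)
    moreover have "mdist Z (g y0) (g y) \<le> C"
      using assms(4) that 0 C by (simp add: isometric_embedding_def)
    ultimately show ?thesis using BC by (simp add: r_def)
  qed
  have "0 < r" using BC by (simp add: r_def add_nonneg_pos)
  moreover have "f ` mspace X \<subseteq> (\<Union>b\<in>g ` mspace Y. mball_of Z b r)"
    using 0 1 in_Z by (auto simp: mdist_commute[of Z "g _"])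
  moreover have "g ` mspace Y \<subseteq> (\<Union>a\<in>f ` mspace X. mball_of Z a r)"
    using 0 2 in_Z by auto
  ultimately show ?thesis by blast
qed

lemma hausdorff_dist_nonneg:
  assumes "compact_metric X" "compact_metric Y"
    "isometric_embedding X Z f" "isometric_embedding Y Z g"
  shows "0 \<le> hausdorff_dist Z (f ` mspace X) (g ` mspace Y)"
  unfolding hausdorff_dist_def
  by (rule cInf_greatest[OF hausdorff_set_nonempty[OF assms]]) auto

lemma hausdorff_less_imp_correspondence:
  assumes "compact_metric X" "compact_metric Y"
    "isometric_embedding X Z f" "isometric_embedding Y Z g"
    "hausdorff_dist Z (f ` mspace X) (g ` mspace Y) < r"
  obtains R where "correspondence X Y R (2 * r)" "0 < r"
proof -
  obtain s where s: "s < r" "0 < s" "f ` mspace X \<subseteq> (\<Union>b\<in>g ` mspace Y. mball_of Z b s)"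
      "g ` mspace Y \<subseteq> (\<Union>a\<in>f ` mspace X. mball_of Z a s)"
    using cInf_lessD[OF hausdorff_set_nonempty[OF assms(1-4)] assms(5)[unfolded hausdorff_dist_def]]
    by blast
  let ?R = "{(x, y). x \<in> mspace X \<and> y \<in> mspace Y \<and> mdist Z (f x) (g y) < r}"
  have in_Z: "x \<in> mspace X \<Longrightarrow> f x \<in> mspace Z" "y \<in> mspace Y \<Longrightarrow> g y \<in> mspace Z" for x y
    using assms by (auto simp: isometric_embedding_def)
  have "correspondence X Y ?R (2 * r)"
  proof (rule correspondenceI)
    fix x assume x: "x \<in> mspace X"
    then obtain y where "y \<in> mspace Y" "mdist Z (g y) (f x) < s" using s(3) by auto
    then show "\<exists>y. (x, y) \<in> ?R" using s(1) x by (auto simp: mdist_commute intro!: exI[of _ y])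
  next
    fix y assume y: "y \<in> mspace Y"
    then obtain x where "x \<in> mspace X" "mdist Z (f x) (g y) < s" using s(4) by auto
    then show "\<exists>x. (x, y) \<in> ?R" using s(1) y by (auto intro!: exI[of _ x])
  next
    fix x y x' y' assume "(x, y) \<in> ?R" "(x', y') \<in> ?R"
    then have m: "x \<in> mspace X" "y \<in> mspace Y" "x' \<in> mspace X" "y' \<in> mspace Y"
      and d: "mdist Z (f x) (g y) < r" "mdist Z (f x') (g y') < r" by auto
    have "mdist Z (f x) (f x') = mdist X x x'" "mdist Z (g y) (g y') = mdist Y y y'"
      using assms m by (auto simp: isometric_embedding_def)
    moreover have "mdist Z (f x) (f x') \<le> mdist Z (f x) (g y) + mdist Z (g y) (f x')"
      "mdist Z (g y) (f x') \<le> mdist Z (g y) (g y') + mdist Z (g y') (f x')"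
      "mdist Z (g y) (g y') \<le> mdist Z (g y) (f x) + mdist Z (f x) (g y')"
      "mdist Z (f x) (g y') \<le> mdist Z (f x) (f x') + mdist Z (f x') (g y')"
      by (intro mdist_triangle in_Z m)+
    moreover have "mdist Z (g y) (f x) = mdist Z (f x) (g y)" "mdist Z (g y') (f x') = mdist Z (f x') (g y')"
      by (simp_all add: mdist_commute)
    ultimately show "\<bar>mdist X x x' - mdist Y y y'\<bar> \<le> 2 * r"
      using d by linarith
  qed auto
  then show thesis using that s by auto
qed

lemma correspondence_imp_realization:
  fixes X :: "'a metric" and Y :: "'b metric"
  assumes X: "compact_metric X" and Y: "compact_metric Y"
    and R: "correspondence X Y R (2 * r)" and r: "0 < r"
  obtains Z :: "real metric" and f g where
    "isometric_embedding X Z f" "isometric_embedding Y Z g"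
    "hausdorff_dist Z (f ` mspace X) (g ` mspace Y) \<le> r"
proof -
  define c where "c x y = (INF (a, b)\<in>R. mdist X x a + r + mdist Y b y)" for x y
  have Rne: "R \<noteq> {}" using R X by (auto simp: correspondence_def compact_metric_def)
  note RD = correspondenceD[OF R]
  have bdd: "bdd_below ((\<lambda>(a, b). mdist X x a + r + mdist Y b y) ` R)" for x y
    using r by (intro bdd_belowI[of _ 0]) (auto intro!: add_nonneg_nonneg)
  have c_le: "c x y \<le> mdist X x a + r + mdist Y b y" if "(a, b) \<in> R" for x y a b
    unfolding c_def using cINF_lower[OF bdd that, of x y] by simp
  have c_ge: "t \<le> c x y" if "\<And>a b. (a, b) \<in> R \<Longrightarrow> t \<le> mdist X x a + r + mdist Y b y" for x y t
    unfolding c_def using that by (intro cINF_greatest[OF Rne]) auto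
  have c_pos: "r \<le> c x y" for x y by (rule c_ge) simp
  have cX: "c x y \<le> mdist X x x' + c x' y" if "x \<in> mspace X" "x' \<in> mspace X" for x x' y
  proof -
    have "c x y - mdist X x x' \<le> c x' y"
    proof (rule c_ge)
      fix a b assume ab: "(a, b) \<in> R"
      have "mdist X x a \<le> mdist X x x' + mdist X x' a"
        using that RD(1)[OF ab] by (intro mdist_triangle)
      with c_le[OF ab, of x y] show "c x y - mdist X x x' \<le> mdist X x' a + r + mdist Y b y"
        by linarith
    qed
    then show ?thesis by simp
  qed
  have cY: "c x y \<le> c x y' + mdist Y y' y" if "y \<in> mspace Y" "y' \<in> mspace Y" for x y y'
  proof -
    have "c x y - mdist Y y' y \<le> c x y'"
    proof (rule c_ge)
      fix a b assume ab: "(a, b) \<in> R"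
      have "mdist Y b y \<le> mdist Y b y' + mdist Y y' y"
        using that RD(2)[OF ab] by (intro mdist_triangle)
      with c_le[OF ab, of x y] show "c x y - mdist Y y' y \<le> mdist X x a + r + mdist Y b y'"
        by linarith
    qed
    then show ?thesis by simp
  qed
  have Xc: "mdist X x x' \<le> c x y + c x' y"
    if x: "x \<in> mspace X" "x' \<in> mspace X" and y: "y \<in> mspace Y" for x x' y
  proof -
    have "mdist X x x' - c x' y \<le> c x y"
    proof (rule c_ge)
      fix a b assume ab: "(a, b) \<in> R"
      have "mdist X x x' - (mdist X x a + r + mdist Y b y) \<le> c x' y"
      proof (rule c_ge)
        fix a' b' assume ab': "(a', b') \<in> R"
        have "mdist X x x' \<le> mdist X x a + mdist X a x'" "mdist X a x' \<le> mdist X a a' + mdist X a' x'"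
          "mdist Y b b' \<le> mdist Y b y + mdist Y y b'"
          by (intro mdist_triangle x y RD(1,2)[OF ab] RD(1,2)[OF ab'])+
        moreover have "mdist X a a' - mdist Y b b' \<le> 2 * r" using RD(5)[OF ab ab'] by linarith
        moreover have "mdist X a' x' = mdist X x' a'" "mdist Y y b' = mdist Y b' y"
          by (simp_all add: mdist_commute)
        ultimately show "mdist X x x' - (mdist X x a + r + mdist Y b y) \<le> mdist X x' a' + r + mdist Y b' y"
          by linarith
      qed
      then show "mdist X x x' - c x' y \<le> mdist X x a + r + mdist Y b y" by linarith
    qed
    then show ?thesis by simp
  qed
  have Yc: "mdist Y y y' \<le> c x y + c x y'"
    if x: "x \<in> mspace X" and y: "y \<in> mspace Y" "y' \<in> mspace Y" for x y y'
  proof -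
    have "mdist Y y y' - c x y' \<le> c x y"
    proof (rule c_ge)
      fix a b assume ab: "(a, b) \<in> R"
      have "mdist Y y y' - (mdist X x a + r + mdist Y b y) \<le> c x y'"
      proof (rule c_ge)
        fix a' b' assume ab': "(a', b') \<in> R"
        have "mdist Y y y' \<le> mdist Y y b + mdist Y b y'" "mdist Y b y' \<le> mdist Y b b' + mdist Y b' y'"
          "mdist X a a' \<le> mdist X a x + mdist X x a'"
          by (intro mdist_triangle x y RD(1,2)[OF ab] RD(1,2)[OF ab'])+
        moreover have "mdist Y b b' - mdist X a a' \<le> 2 * r" using RD(5)[OF ab ab'] by linarith
        moreover have "mdist X a x = mdist X x a" "mdist Y y b = mdist Y b y"
          by (simp_all add: mdist_commute)
        ultimately show "mdist Y y y' - (mdist X x a + r + mdist Y b y) \<le> mdist X x a' + r + mdist Y b' y'"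
          by linarith
      qed
      then show "mdist Y y y' - c x y' \<le> mdist X x a + r + mdist Y b y" by linarith
    qed
    then show ?thesis by simp
  qed
  define dd where "dd p q = (case p of
      Inl x \<Rightarrow> (case q of Inl x' \<Rightarrow> mdist X x x' | Inr y \<Rightarrow> c x y)
    | Inr y \<Rightarrow> (case q of Inl x \<Rightarrow> c x y | Inr y' \<Rightarrow> mdist Y y y'))" for p q
  have dd[simp]: "dd (Inl x) (Inl x') = mdist X x x'" "dd (Inl x) (Inr y) = c x y"
    "dd (Inr y) (Inl x) = c x y" "dd (Inr y) (Inr y') = mdist Y y y'" for x x' y y'
    by (simp_all add: dd_def)
  define W where "W = mspace X <+> mspace Y"
  have MW: "Metric_space W dd"
  proof
    show "0 \<le> dd p q" for p q
      using r c_pos by (cases p; cases q) (auto intro: order_trans[OF less_imp_le])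
    show "dd p q = dd q p" for p q
      by (cases p; cases q) (auto simp: mdist_commute)
    fix p q assume "p \<in> W" "q \<in> W"
    moreover have "c x y \<noteq> 0" for x y using r c_pos[of x y] by linarith
    ultimately show "dd p q = 0 \<longleftrightarrow> p = q"
      by (auto simp: W_def)
  next
    fix p q s assume "p \<in> W" "q \<in> W" "s \<in> W"
    then show "dd p s \<le> dd p q + dd q s"
      unfolding W_def
      using cX cY Xc Yc
      by (elim PlusE; simp add: mdist_triangle)
         (simp_all add: mdist_commute add.commute)
  qed
  obtain h k :: "_ \<Rightarrow> real" where h: "inj_on h (mspace X)" and k: "inj_on k (mspace Y)"
    using compact_metric_inj_real[OF X] compact_metric_inj_real[OF Y] by metis
  define j where "j p = (case p of Inl x \<Rightarrow> exp (h x) | Inr y \<Rightarrow> - exp (k y))" for p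
  have jne: "exp (h x) \<noteq> - exp (k y)" for x y
    using exp_gt_zero[of "h x"] exp_gt_zero[of "k y"] by linarith
  have "inj_on j W"
  proof (rule inj_onI)
    fix p q assume "p \<in> W" "q \<in> W" "j p = j q"
    then show "p = q"
      unfolding W_def j_def using jne jne[symmetric] h k
      by (elim PlusE; simp) (meson inj_onD)+
  qed
  then have "inj_on j (mspace (metric (W, dd)))" by (simp add: Metric_space.mspace_metric[OF MW])
  then obtain Z :: "real metric" where Z: "mspace Z = j ` W" "isometric_embedding (metric (W, dd)) Z j"
    using transport_metric[of j "metric (W, dd)"] Metric_space.mspace_metric[OF MW] by auto
  have jd: "mdist Z (j p) (j q) = dd p q" if "p \<in> W" "q \<in> W" for p q
    using Z(2) that by (simp add: isometric_embedding_def Metric_space.mspace_metric[OF MW] Metric_space.mdist_metric[OF MW])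
  show thesis
  proof (rule that)
    show f: "isometric_embedding X Z (j \<circ> Inl)" and g: "isometric_embedding Y Z (j \<circ> Inr)"
      using jd by (auto simp: isometric_embedding_def Z(1) W_def InlI InrI)
    show "hausdorff_dist Z ((j \<circ> Inl) ` mspace X) ((j \<circ> Inr) ` mspace Y) \<le> r"
    proof (rule field_le_epsilon)
      fix e :: real assume e: "0 < e"
      have cr: "c x y < r + e" if "(x, y) \<in> R" for x y
      proof -
        have "mdist X x x = 0" "mdist Y y y = 0" using RD(1,2)[OF that] by simp_all
        then show ?thesis using c_le[OF that, of x y] e by linarith
      qed
      show "hausdorff_dist Z ((j \<circ> Inl) ` mspace X) ((j \<circ> Inr) ` mspace Y) \<le> r + e"
      proof (rule hausdorff_dist_le)
        fix a assume "a \<in> (j \<circ> Inl) ` mspace X"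
        then obtain x where x: "x \<in> mspace X" "a = j (Inl x)" by auto
        then obtain y where y: "(x, y) \<in> R" using RD(3) by blast
        then have "mdist Z a (j (Inr y)) < r + e" "y \<in> mspace Y"
          using x cr RD(2) by (auto simp: jd W_def InlI InrI)
        then show "\<exists>b\<in>(j \<circ> Inr) ` mspace Y. mdist Z a b < r + e" by auto
      next
        fix b assume "b \<in> (j \<circ> Inr) ` mspace Y"
        then obtain y where y: "y \<in> mspace Y" "b = j (Inr y)" by auto
        then obtain x where x: "(x, y) \<in> R" using RD(4) by blast
        then have "mdist Z (j (Inl x)) b < r + e" "x \<in> mspace X"
          using y cr RD(1) by (auto simp: jd W_def InlI InrI)
        then show "\<exists>a\<in>(j \<circ> Inl) ` mspace X. mdist Z a b < r + e" by auto
      qed (use r e in \<open>auto simp: Z(1) W_def\<close>)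
    qed
  qed
qed

lemma GH_dist_le_of_correspondence:
  assumes X: "compact_metric X" and Y: "compact_metric Y"
    and R: "correspondence X Y R (2 * r)" and r: "0 < r"
  shows "GH_dist X Y \<le> r"
proof -
  obtain Z :: "real metric" and f g where Z:
    "isometric_embedding X Z f" "isometric_embedding Y Z g"
    "hausdorff_dist Z (f ` mspace X) (g ` mspace Y) \<le> r"
    using correspondence_imp_realization[OF assms] .
  have "GH_dist X Y \<le> hausdorff_dist Z (f ` mspace X) (g ` mspace Y)"
    unfolding GH_dist_def
    by (rule cInf_lower) (use Z hausdorff_dist_nonneg[OF X Y] in \<open>auto intro!: bdd_belowI[of _ 0]\<close>)
  with Z show ?thesis by linarith
qed

lemma GH_set_nonempty:
  assumes X: "compact_metric X" and Y: "compact_metric Y"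
  shows "{hausdorff_dist Z (f ` mspace X) (g ` mspace Y) | (Z :: real metric) f g.
            isometric_embedding X Z f \<and> isometric_embedding Y Z g} \<noteq> {}"
proof -
  obtain B where B: "\<And>x y. x \<in> mspace X \<Longrightarrow> y \<in> mspace X \<Longrightarrow> mdist X x y \<le> B"
    using compact_metric_mbounded[OF X] by blast
  obtain C where C: "\<And>x y. x \<in> mspace Y \<Longrightarrow> y \<in> mspace Y \<Longrightarrow> mdist Y x y \<le> C"
    using compact_metric_mbounded[OF Y] by blast
  obtain x0 y0 where 0: "x0 \<in> mspace X" "y0 \<in> mspace Y"
    using assms by (auto simp: compact_metric_def)
  have BC: "0 \<le> B" "0 \<le> C"
    using B[OF 0(1) 0(1)] C[OF 0(2) 0(2)] mdist_nonneg[of X x0 x0] mdist_nonneg[of Y y0 y0] by linarith+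
  have "correspondence X Y (mspace X \<times> mspace Y) (2 * (B + C + 1))"
  proof (rule correspondenceI)
    fix x y x' y' assume "(x, y) \<in> mspace X \<times> mspace Y" "(x', y') \<in> mspace X \<times> mspace Y"
    then have "mdist X x x' \<le> B" "mdist Y y y' \<le> C" using B C by auto
    moreover have "\<bar>s - t\<bar> \<le> 2 * B + 2 * C + 2" if "0 \<le> s" "0 \<le> t" "s \<le> B" "t \<le> C" for s t
      using that by linarith
    ultimately have "\<bar>mdist X x x' - mdist Y y y'\<bar> \<le> 2 * B + 2 * C + 2"
      by simp
    then show "\<bar>mdist X x x' - mdist Y y y'\<bar> \<le> 2 * (B + C + 1)"
      by simp
  qed (use 0 in auto)
  then show ?thesis
    using correspondence_imp_realization[OF X Y] BC by (smt (verit) empty_iff mem_Collect_eq)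
qed

lemma GH_dist_less_imp_correspondence:
  assumes X: "compact_metric X" and Y: "compact_metric Y" and "GH_dist X Y < r"
  obtains R where "correspondence X Y R (2 * r)" "0 < r"
proof -
  obtain Z :: "real metric" and f g where
    "isometric_embedding X Z f" "isometric_embedding Y Z g"
    "hausdorff_dist Z (f ` mspace X) (g ` mspace Y) < r"
    using cInf_lessD[OF GH_set_nonempty[OF X Y] assms(3)[unfolded GH_dist_def]] by blast
  then show thesis using hausdorff_less_imp_correspondence[OF X Y] that by metis
qed

theorem GH_dist_le:
  fixes Z :: "'c metric"
  assumes "compact_metric X" "compact_metric Y"
    "isometric_embedding X Z f" "isometric_embedding Y Z g"
  shows "GH_dist X Y \<le> hausdorff_dist Z (f ` mspace X) (g ` mspace Y)"
proof (rule dense_ge)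
  fix r assume "hausdorff_dist Z (f ` mspace X) (g ` mspace Y) < r"
  then obtain R where "correspondence X Y R (2 * r)" "0 < r"
    using hausdorff_less_imp_correspondence[OF assms] by metis
  then show "GH_dist X Y \<le> r" using GH_dist_le_of_correspondence assms by blast
qed

lemma GH_dist_nonneg:
  assumes X: "compact_metric X" and Y: "compact_metric Y"
  shows "0 \<le> GH_dist X Y"
  by (metis GH_dist_less_imp_correspondence X Y less_irrefl not_le)

lemma GH_dist_commute_le:
  assumes X: "compact_metric X" and Y: "compact_metric Y"
  shows "GH_dist Y X \<le> GH_dist X Y"
proof (rule dense_ge)
  fix r assume "GH_dist X Y < r"
  then obtain R where "correspondence X Y R (2 * r)" "0 < r"
    using GH_dist_less_imp_correspondence[OF X Y] by metis
  then show "GH_dist Y X \<le> r"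
    using GH_dist_le_of_correspondence[OF Y X] correspondence_converse by blast
qed

lemma GH_dist_commute:
  assumes X: "compact_metric X" and Y: "compact_metric Y"
  shows "GH_dist X Y = GH_dist Y X"
  using GH_dist_commute_le assms by (metis order_antisym)

lemma GH_dist_triangle:
  assumes X: "compact_metric X" and Y: "compact_metric Y" and Z: "compact_metric Z"
  shows "GH_dist X Z \<le> GH_dist X Y + GH_dist Y Z"
proof (rule field_le_epsilon)
  fix e :: real assume e: "0 < e"
  obtain R where R: "correspondence X Y R (2 * (GH_dist X Y + e/2))" "0 < GH_dist X Y + e/2"
    using GH_dist_less_imp_correspondence[OF X Y, of "GH_dist X Y + e/2"] e by auto
  obtain S where S: "correspondence Y Z S (2 * (GH_dist Y Z + e/2))" "0 < GH_dist Y Z + e/2"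
    using GH_dist_less_imp_correspondence[OF Y Z, of "GH_dist Y Z + e/2"] e by auto
  have "2 * (GH_dist X Y + e/2) + 2 * (GH_dist Y Z + e/2) = 2 * (GH_dist X Y + GH_dist Y Z + e)"
    by simp
  then have "correspondence X Z (R O S) (2 * (GH_dist X Y + GH_dist Y Z + e))"
    using correspondence_comp[OF R(1) S(1)] by metis
  then show "GH_dist X Z \<le> GH_dist X Y + GH_dist Y Z + e"
    by (rule GH_dist_le_of_correspondence[OF X Z]) (use R S in linarith)
qed

lemma GH_dist_isometric:
  assumes X: "compact_metric X" and Y: "compact_metric Y" and "isometric X Y"
  shows "GH_dist X Y = 0"
proof (rule antisym)
  obtain f where f: "isometric_embedding X Y f" "f ` mspace X = mspace Y"
    using assms by (auto simp: isometric_def)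
  show "GH_dist X Y \<le> 0"
  proof (rule dense_ge)
    fix r :: real assume r: "0 < r"
    have "correspondence X Y {(x, f x) | x. x \<in> mspace X} (2 * r)"
      by (rule correspondenceI) (use f r in \<open>auto simp: isometric_embedding_def\<close>)
    then show "GH_dist X Y \<le> r" using GH_dist_le_of_correspondence[OF X Y] r by blast
  qed
qed (rule GH_dist_nonneg[OF X Y])

text \<open>A space at distance 0 from X receives an isometric embedding of X, by compactness of the
  space of all maps with the product topology.\<close>

lemma GH_dist_0_imp_embedding:
  assumes X: "compact_metric X" and Y: "compact_metric Y" and 0: "GH_dist X Y = 0"
  obtains f where "isometric_embedding X Y f"
proof -
  define u where "u n = inverse (real (Suc n))" for n
  have u: "0 < u n" for n by (simp add: u_def)
  have "\<exists>R. correspondence X Y R (2 * u n)" for n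
    using GH_dist_less_imp_correspondence[OF X Y] 0 u by metis
  then obtain R where R: "\<And>n. correspondence X Y (R n) (2 * u n)" by metis
  define F where "F n x = (SOME y. (x, y) \<in> R n)" for n x
  have F: "(x, F n x) \<in> R n" if "x \<in> mspace X" for x n
    unfolding F_def using correspondenceD(3)[OF R that] by (rule someI_ex)
  define G where "G n = restrict (F n) (mspace X)" for n
  let ?P = "product_topology (\<lambda>_. mtopology_of Y) (mspace X)"
  have GP: "G n \<in> topspace ?P" for n
    using correspondenceD(2)[OF R F] by (auto simp: G_def)
  define C where "C n = ?P closure_of (G ` {n..})" for n
  have "(\<Inter>n. C n) \<noteq> {}"
  proof (rule compact_space_imp_nest)
    show "compact_space ?P"
      using Y by (simp add: compact_space_product_topology compact_metric_def)
    show "closedin ?P (C n)" for n by (simp add: C_def)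
    show "C n \<noteq> {}" for n
    proof -
      have "G ` {n..} \<subseteq> C n" unfolding C_def using GP by (intro closure_of_subset) auto
      then show ?thesis by auto
    qed
    show "decseq C"
      unfolding C_def by (intro decseq_SucI closure_of_mono image_mono) auto
  qed
  then obtain f where f: "\<And>n. f \<in> C n" by auto
  have fP: "f \<in> topspace ?P" using f[of 0] subsetD[OF closure_of_subset_topspace] unfolding C_def by fast
  then have fY: "f x \<in> mspace Y" if "x \<in> mspace X" for x using that by auto
  have "mdist Y (f x) (f y) = mdist X x y" if xy: "x \<in> mspace X" "y \<in> mspace X" for x y
  proof (rule ccontr)
    assume ne: "mdist Y (f x) (f y) \<noteq> mdist X x y"
    define e where "e = \<bar>mdist Y (f x) (f y) - mdist X x y\<bar> / 4"
    have e: "0 < e" using ne by (simp add: e_def)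
    then obtain n where n: "u n < e" unfolding u_def using reals_Archimedean by metis
    define U where "U = {g \<in> topspace ?P. g x \<in> mball_of Y (f x) e} \<inter> {g \<in> topspace ?P. g y \<in> mball_of Y (f y) e}"
    have ball: "openin (mtopology_of Y) (mball_of Y z e)" for z
      by (simp add: mtopology_of_def mball_of_def Metric_space.openin_mball)
    have "openin ?P U"
      unfolding U_def
      by (intro openin_Int openin_continuous_map_preimage[OF continuous_map_product_projection] ball xy)
    moreover have "f \<in> U"
    proof -
      have "mdist Y (f z) (f z) < e" if "z \<in> mspace X" for z
        using e mdist_zero[OF fY fY, OF that that] by presburger
      from this[OF xy(1)] this[OF xy(2)] show ?thesis using fP fY xy e by (simp add: U_def)
    qed
    ultimately obtain m where m: "m \<ge> n" "G m \<in> U"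
      using f[of n] unfolding C_def in_closure_of by blast
    have Gm: "G m x \<in> mspace Y" "G m y \<in> mspace Y" using GP[of m] xy by auto
    have "mdist Y (f x) (G m x) < e" "mdist Y (f y) (G m y) < e" using m(2) by (auto simp: U_def)
    moreover have "\<bar>mdist X x y - mdist Y (G m x) (G m y)\<bar> \<le> 2 * u m"
      using correspondenceD(5)[OF R F F] xy by (simp add: G_def)
    moreover have "u m \<le> u n" using m(1) by (simp add: u_def divide_simps)
    moreover have "mdist Y (f x) (f y) \<le> mdist Y (f x) (G m x) + mdist Y (G m x) (f y)"
      "mdist Y (G m x) (f y) \<le> mdist Y (G m x) (G m y) + mdist Y (G m y) (f y)"
      "mdist Y (G m x) (G m y) \<le> mdist Y (G m x) (f x) + mdist Y (f x) (G m y)"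
      "mdist Y (f x) (G m y) \<le> mdist Y (f x) (f y) + mdist Y (f y) (G m y)"
      by (intro mdist_triangle fY Gm xy)+
    moreover have "mdist Y (G m x) (f x) = mdist Y (f x) (G m x)" "mdist Y (G m y) (f y) = mdist Y (f y) (G m y)"
      by (simp_all add: mdist_commute)
    ultimately have "\<bar>mdist Y (f x) (f y) - mdist X x y\<bar> < 4 * e"
      using n by linarith
    then show False by (simp add: e_def)
  qed
  then have "isometric_embedding X Y f" using fY by (auto simp: isometric_embedding_def)
  then show thesis by (rule that)
qed

lemma isometric_self_embedding_surj:
  assumes X: "compact_metric X" and f: "isometric_embedding X X f"
  shows "f ` mspace X = mspace X"
proof (rule ccontr)
  interpret M: Metric_space "mspace X" "mdist X" by simp
  interpret Metric_space12 "mspace X" "mdist X" "mspace X" "mdist X" by (simp add: Metric_space12_def)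
  have fX: "x \<in> mspace X \<Longrightarrow> f x \<in> mspace X" for x using f by (auto simp: isometric_embedding_def)
  have fd: "mdist X (f x) (f y) = mdist X x y" if "x \<in> mspace X" "y \<in> mspace X" for x y
    using f that by (auto simp: isometric_embedding_def)
  assume "f ` mspace X \<noteq> mspace X"
  then obtain z where z: "z \<in> mspace X" "z \<notin> f ` mspace X" using fX by blast
  have cX: "compactin M.mtopology (mspace X)"
    using X by (simp add: compact_metric_def compact_space_def mtopology_of_def)
  have "embedding_map M.mtopology M.mtopology f"
    by (rule isometry_imp_embedding_map) (use fX fd in auto)
  then have "continuous_map M.mtopology M.mtopology f"
    by (simp add: continuous_map_in_subtopology embedding_map_def homeomorphic_imp_continuous_map
        continuous_map_from_subtopology homeomorphic_eq_everything_map)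
  then have "compactin M.mtopology (f ` mspace X)"
    using cX image_compactin by blast
  then have "closedin M.mtopology (f ` mspace X)"
    using M.Hausdorff_space_mtopology by (rule compactin_imp_closedin[rotated])
  then have "\<exists>e>0. disjnt (f ` mspace X) (M.mball z e)"
    using z by (simp add: M.closedin_metric)
  then obtain e where e: "e > 0" "f ` mspace X \<inter> M.mball z e = {}"
    by (auto simp: disjnt_def)
  define s where "s n = (f ^^ n) z" for n
  have sX: "s n \<in> mspace X" for n by (induction n) (auto simp: s_def z fX)
  have shift: "mdist X (s n) (s (n + Suc k)) \<ge> e" for n k
  proof (induction n)
    case 0
    have "s (Suc k) \<in> f ` mspace X" using sX[of k] by (simp add: s_def)
    then have "s (Suc k) \<notin> M.mball z e" using e by blast
    then show ?case using z sX[of "Suc k"] by (simp add: s_def)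
  next
    case (Suc n)
    then show ?case using fd[OF sX[of n] sX[of "n + Suc k"]] by (simp add: s_def)
  qed
  have "M.mtotally_bounded (mspace X)" using cX by (rule M.compactin_imp_mtotally_bounded)
  then obtain r where r: "strict_mono (r :: nat \<Rightarrow> nat)" "M.MCauchy (s \<circ> r)"
    using sX unfolding M.mtotally_bounded_sequentially by blast
  then obtain N where "\<And>n n'. N \<le> n \<Longrightarrow> N \<le> n' \<Longrightarrow> mdist X (s (r n)) (s (r n')) < e"
    using e(1) unfolding M.MCauchy_def o_def by meson
  then have "mdist X (s (r N)) (s (r (Suc N))) < e" by auto
  moreover have "r N < r (Suc N)" using r(1) by (simp add: strict_mono_def)
  then obtain k where "r (Suc N) = r N + Suc k" by (metis less_iff_Suc_add add_Suc_right)
  ultimately show False using shift[of "r N" k] by simp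
qed

theorem GH_dist_eq_0_iff:
  assumes X: "compact_metric X" and Y: "compact_metric Y"
  shows "GH_dist X Y = 0 \<longleftrightarrow> isometric X Y"
proof
  assume 0: "GH_dist X Y = 0"
  obtain f where f: "isometric_embedding X Y f" using GH_dist_0_imp_embedding[OF X Y 0] .
  have "GH_dist Y X = 0" using 0 GH_dist_commute[OF X Y] by simp
  then obtain g where g: "isometric_embedding Y X g" using GH_dist_0_imp_embedding[OF Y X] by blast
  have "(f \<circ> g) ` mspace Y = mspace Y"
    by (rule isometric_self_embedding_surj[OF Y isometric_embedding_comp[OF g f]])
  then have "f ` (g ` mspace Y) = mspace Y" by (simp only: image_comp)
  moreover have "g ` mspace Y \<subseteq> mspace X" "f ` mspace X \<subseteq> mspace Y"
    using f g unfolding isometric_embedding_def by blast+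
  ultimately have "f ` mspace X = mspace Y" by blast
  with f show "isometric X Y" by (auto simp: isometric_def)
qed (rule GH_dist_isometric[OF X Y])

lemma GH_dist_cong:
  assumes "compact_metric X" "compact_metric X'" "compact_metric Y" "compact_metric Y'"
    "isometric X X'" "isometric Y Y'"
  shows "GH_dist X Y = GH_dist X' Y'"
proof -
  have "GH_dist X X' = 0" "GH_dist Y Y' = 0" "GH_dist X' X = 0" "GH_dist Y' Y = 0"
    using assms GH_dist_isometric isometric_sym by blast+
  moreover have "GH_dist X Y \<le> GH_dist X X' + GH_dist X' Y" "GH_dist X' Y \<le> GH_dist X' Y' + GH_dist Y' Y"
    "GH_dist X' Y' \<le> GH_dist X' X + GH_dist X Y'" "GH_dist X Y' \<le> GH_dist X Y + GH_dist Y Y'"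
    by (intro GH_dist_triangle assms)+
  ultimately show ?thesis by linarith
qed


subsection \<open>The Gromov--Hausdorff space is a metric space\<close>

lemma isometry_class_some:
  fixes V :: "'a metric"
  assumes "compact_metric V"
  shows "compact_metric (SOME W. W \<in> isometry_class V)" "isometric V (SOME W. W \<in> isometry_class V)"
proof -
  obtain W :: "real metric" where "compact_metric W" "isometric V W"
    using isometric_real_exists[OF assms] by blast
  then have "W \<in> isometry_class V" by (simp add: isometry_class_def)
  then have "(SOME W. W \<in> isometry_class V) \<in> isometry_class V" by (rule someI)
  then show "compact_metric (SOME W. W \<in> isometry_class V)" "isometric V (SOME W. W \<in> isometry_class V)"
    by (simp_all add: isometry_class_def)
qed

lemma class_dist_eq:
  assumes X: "compact_metric X" and Y: "compact_metric Y"
  shows "class_dist (isometry_class X) (isometry_class Y) = GH_dist X Y"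
  unfolding class_dist_def
  using isometry_class_in_classes[OF X] isometry_class_in_classes[OF Y]
    GH_dist_cong[OF X isometry_class_some(1)[OF X] Y isometry_class_some(1)[OF Y]
      isometry_class_some(2)[OF X] isometry_class_some(2)[OF Y]] by simp

lemma isometry_classesE:
  assumes "C \<in> isometry_classes"
  obtains X :: "real metric" where "compact_metric X" "C = isometry_class X"
  using assms unfolding isometry_classes_def by blast

theorem Metric_space_GH: "Metric_space isometry_classes class_dist"
proof
  show "0 \<le> class_dist C D" for C D
  proof (cases "C \<in> isometry_classes \<and> D \<in> isometry_classes")
    case True
    then obtain X Y :: "real metric" where
      "compact_metric X" "C = isometry_class X" "compact_metric Y" "D = isometry_class Y"
      by (blast elim: isometry_classesE)
    then show ?thesis by (simp add: GH_dist_nonneg class_dist_eq)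
  qed (auto simp: class_dist_def)
  show "class_dist C D = class_dist D C" for C D
  proof (cases "C \<in> isometry_classes \<and> D \<in> isometry_classes")
    case True
    then obtain X Y :: "real metric" where
      "compact_metric X" "C = isometry_class X" "compact_metric Y" "D = isometry_class Y"
      by (blast elim: isometry_classesE)
    then show ?thesis using GH_dist_commute[of X Y] by (simp add: class_dist_eq)
  qed (auto simp: class_dist_def)
  show "class_dist C D = 0 \<longleftrightarrow> C = D" if "C \<in> isometry_classes" "D \<in> isometry_classes" for C D
  proof -
    obtain X Y :: "real metric" where
      "compact_metric X" "C = isometry_class X" "compact_metric Y" "D = isometry_class Y"
      using \<open>C \<in> _\<close> \<open>D \<in> _\<close> by (blast elim: isometry_classesE)
    then show ?thesis by (simp add: class_dist_eq GH_dist_eq_0_iff isometry_class_eq_iff)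
  qed
  show "class_dist C E \<le> class_dist C D + class_dist D E"
    if CDE: "C \<in> isometry_classes" "D \<in> isometry_classes" "E \<in> isometry_classes" for C D E
  proof -
    obtain X :: "real metric" where "compact_metric X" "C = isometry_class X"
      using CDE(1) by (rule isometry_classesE)
    moreover obtain Y :: "real metric" where "compact_metric Y" "D = isometry_class Y"
      using CDE(2) by (rule isometry_classesE)
    moreover obtain Z :: "real metric" where "compact_metric Z" "E = isometry_class Z"
      using CDE(3) by (rule isometry_classesE)
    ultimately show ?thesis by (simp add: class_dist_eq GH_dist_triangle)
  qed
qed

lemma mspace_GH_space [simp]: "mspace GH_space = isometry_classes"
  and mdist_GH_space [simp]: "mdist GH_space = class_dist"
  using Metric_space.mspace_metric[OF Metric_space_GH] Metric_space.mdist_metric[OF Metric_space_GH]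
  by (simp_all add: GH_space_def)

theorem isometry_class_in_GH:
  fixes X :: "'a metric"
  assumes "compact_metric X"
  shows "isometry_class X \<in> mspace GH_space"
  using isometry_class_in_classes[OF assms] by simp

theorem mdist_GH_space_class:
  fixes X :: "'a metric" and Y :: "'b metric"
  assumes "compact_metric X" "compact_metric Y"
  shows "mdist GH_space (isometry_class X) (isometry_class Y) = GH_dist X Y"
  using class_dist_eq[OF assms] by simp


subsection \<open>Minimal fillings may be taken in arbitrary metric spaces\<close>

lemma edge_length_doubleton [simp]: "edge_length X {v, w} = mdist X v w"
  unfolding edge_length_def
  by (rule the_equality) (auto simp: doubleton_eq_iff mdist_commute)

lemma edge_length_nonneg: "graph_on X G \<Longrightarrow> e \<in> snd G \<Longrightarrow> 0 \<le> edge_length X e"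
  unfolding graph_on_def by fastforce

lemma graph_length_nonneg: "graph_on X G \<Longrightarrow> 0 \<le> graph_length X G"
  unfolding graph_length_def by (intro sum_nonneg edge_length_nonneg)

lemma smt_set_nonempty:
  assumes "finite M" "M \<subseteq> mspace X"
  shows "{graph_length X G | G. graph_on X G \<and> connected_graph G \<and> M \<subseteq> fst G} \<noteq> {}"
proof -
  let ?G = "(M, {{v, w} | v w. v \<in> M \<and> w \<in> M \<and> v \<noteq> w})"
  have "connected_graph ?G"
    unfolding connected_graph_def
  proof (intro ballI)
    fix v w assume "v \<in> fst ?G" "w \<in> fst ?G"
    then show "(v, w) \<in> {(x, y). {x, y} \<in> snd ?G}\<^sup>*"
      by (cases "v = w") (auto intro!: r_into_rtrancl)
  qed
  moreover have "graph_on X ?G" using assms by (auto simp: graph_on_def)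
  ultimately show ?thesis by auto
qed

lemma smt_le:
  assumes "graph_on X G" "connected_graph G" "M \<subseteq> fst G"
  shows "smt M X \<le> graph_length X G"
  unfolding smt_def
proof (rule cInf_lower)
  show "graph_length X G \<in> {graph_length X G | G. graph_on X G \<and> connected_graph G \<and> M \<subseteq> fst G}"
    using assms by blast
  show "bdd_below {graph_length X G | G. graph_on X G \<and> connected_graph G \<and> M \<subseteq> fst G}"
    using graph_length_nonneg by (intro bdd_belowI[of _ 0]) blast
qed

lemma smt_nonneg:
  assumes "finite M" "M \<subseteq> mspace X"
  shows "0 \<le> smt M X"
  unfolding smt_def
  by (rule cInf_greatest[OF smt_set_nonempty[OF assms]]) (use graph_length_nonneg in blast)

lemma map_graph:
  assumes G: "graph_on X G" "connected_graph G" and f: "isometric_embedding (submetric X (fst G)) Y f"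
  shows "graph_on Y (f ` fst G, image f ` snd G)" "connected_graph (f ` fst G, image f ` snd G)"
    "graph_length Y (f ` fst G, image f ` snd G) = graph_length X G"
proof -
  have V: "finite (fst G)" "fst G \<subseteq> mspace X"
    and E: "\<And>e. e \<in> snd G \<Longrightarrow> \<exists>v w. e = {v, w} \<and> v \<in> fst G \<and> w \<in> fst G \<and> v \<noteq> w"
    using G(1) unfolding graph_on_def by blast+
  have sub: "mspace (submetric X (fst G)) = fst G" using V by auto
  have inj: "inj_on f (fst G)" using isometric_embedding_inj[OF f] sub by simp
  have fY: "f ` fst G \<subseteq> mspace Y" using f sub by (auto simp: isometric_embedding_def)
  have fd: "mdist Y (f v) (f w) = mdist X v w" if "v \<in> fst G" "w \<in> fst G" for v w
    using f that sub by (auto simp: isometric_embedding_def)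
  have E': "e \<in> {{v, w} | v w. v \<in> f ` fst G \<and> w \<in> f ` fst G \<and> v \<noteq> w}" if e: "e \<in> image f ` snd G" for e
  proof -
    obtain e' where "e' \<in> snd G" "e = f ` e'" using e by blast
    moreover from E[OF this(1)] obtain v w where "e' = {v, w}" "v \<in> fst G" "w \<in> fst G" "v \<noteq> w" by blast
    ultimately have vw: "e = {f v, f w}" "v \<in> fst G" "w \<in> fst G" "v \<noteq> w" by simp_all
    then have "f v \<noteq> f w" using inj by (auto dest: inj_onD)
    with vw show ?thesis by blast
  qed
  show "graph_on Y (f ` fst G, image f ` snd G)"
    unfolding graph_on_def using V fY E' by auto
  show "connected_graph (f ` fst G, image f ` snd G)"
    unfolding connected_graph_def
  proof (intro ballI)
    fix a b assume "a \<in> fst (f ` fst G, image f ` snd G)" "b \<in> fst (f ` fst G, image f ` snd G)"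
    then obtain v w where vw: "a = f v" "b = f w" "v \<in> fst G" "w \<in> fst G" by auto
    then have "(v, w) \<in> {(x, y). {x, y} \<in> snd G}\<^sup>*" using G(2) by (auto simp: connected_graph_def)
    then have "(f v, f w) \<in> {(x, y). {x, y} \<in> image f ` snd G}\<^sup>*"
    proof (induction rule: rtrancl_induct)
      case (step y z)
      then have "{f y, f z} \<in> image f ` snd G"
        using image_eqI[of "{f y, f z}" "image f" "{y, z}" "snd G"] by simp
      with step show ?case by (auto intro: rtrancl_into_rtrancl)
    qed simp
    then show "(a, b) \<in> {(x, y). {x, y} \<in> snd (f ` fst G, image f ` snd G)}\<^sup>*" using vw by simp
  qed
  have "inj_on (image f) (snd G)"
    using inj_on_image_Pow[OF inj] by (rule inj_on_subset) (use E in blast)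
  then have "graph_length Y (f ` fst G, image f ` snd G) = (\<Sum>e\<in>snd G. edge_length Y (f ` e))"
    unfolding graph_length_def by (simp add: sum.reindex)
  also have "\<dots> = graph_length X G"
    unfolding graph_length_def
  proof (rule sum.cong)
    fix e assume "e \<in> snd G"
    then obtain v w where "e = {v, w}" "v \<in> fst G" "w \<in> fst G" using E by blast
    then show "edge_length Y (f ` e) = edge_length X e" by (simp add: fd)
  qed simp
  finally show "graph_length Y (f ` fst G, image f ` snd G) = graph_length X G" .
qed

theorem mf_le:
  fixes X :: "'b metric"
  assumes fin: "finite (mspace M)" and \<mu>: "isometric_embedding M X \<mu>"
  shows "mf M \<le> smt (\<mu> ` mspace M) X"
proof (rule dense_ge)
  fix r assume r: "smt (\<mu> ` mspace M) X < r"
  have \<mu>X: "\<mu> ` mspace M \<subseteq> mspace X" using \<mu> by (auto simp: isometric_embedding_def)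
  obtain G where G: "graph_on X G" "connected_graph G" "\<mu> ` mspace M \<subseteq> fst G" "graph_length X G < r"
    using cInf_lessD[OF smt_set_nonempty[OF finite_imageI[OF fin] \<mu>X] r[unfolded smt_def]] by blast
  have V: "finite (fst G)" "fst G \<subseteq> mspace X" using G(1) unfolding graph_on_def by blast+
  have sub: "mspace (submetric X (fst G)) = fst G" using V by auto
  obtain h :: "'b \<Rightarrow> real" where h: "inj_on h (fst G)"
  proof
    show "inj_on (real \<circ> to_nat_on (fst G)) (fst G)"
      using V(1) by (intro comp_inj_on inj_on_to_nat_on countable_finite) (auto simp: inj_on_def)
  qed
  then have "inj_on h (mspace (submetric X (fst G)))" by (simp only: sub)
  then obtain Y :: "real metric" where
    "mspace Y = h ` mspace (submetric X (fst G))" and Y: "isometric_embedding (submetric X (fst G)) Y h"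
    by (rule transport_metric)
  have emb: "isometric_embedding M Y (h \<circ> \<mu>)"
  proof (rule isometric_embedding_comp[OF _ Y])
    show "isometric_embedding M (submetric X (fst G)) \<mu>"
      using \<mu> G(3) \<mu>X by (auto simp: isometric_embedding_def)
  qed
  have "smt ((h \<circ> \<mu>) ` mspace M) Y \<le> graph_length Y (h ` fst G, image h ` snd G)"
    by (rule smt_le[OF map_graph(1,2)[OF G(1,2) Y]]) (use G(3) in auto)
  also have "\<dots> \<le> r" using map_graph(3)[OF G(1,2) Y] G(4) by simp
  finally have mem: "r \<in> {r. \<exists>(X :: real metric) \<mu>. isometric_embedding M X \<mu> \<and> smt (\<mu> ` mspace M) X \<le> r}"
    using emb by blast
  show "mf M \<le> r"
    unfolding mf_def
  proof (rule cInf_lower[OF mem], rule bdd_belowI[of _ 0])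
    fix s assume "s \<in> {r. \<exists>(X :: real metric) \<mu>. isometric_embedding M X \<mu> \<and> smt (\<mu> ` mspace M) X \<le> r}"
    then obtain W :: "real metric" and \<nu> where W: "isometric_embedding M W \<nu>" "smt (\<nu> ` mspace M) W \<le> s" by auto
    have "0 \<le> smt (\<nu> ` mspace M) W"
      by (rule smt_nonneg) (use W fin in \<open>auto simp: isometric_embedding_def\<close>)
    with W show "0 \<le> s" by linarith
  qed
qed

end

theory Submission
  imports Defs
begin

text \<open>
  Write \<open>X(a, b, c)\<close> for the space on points 0, 1, 2 with distances a = 01, b = 02, c = 12.
  Matching points of the same name shows that any two of the \<open>A\<^sup>i\<close> are at Gromov--Hausdorff distance
  at most 2, half the largest difference of corresponding sides. Hence coning off M by a new point at
  distance 1 from all three gives a metric space, and \<open>mf M \<le> 3\<close> (\<open>mf_le_cone\<close>).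

  On the other hand a connected graph through three points is at least as long as some tripod with
  these three ends (\<open>connected_graph_tripod_le\<close>), so \<open>smt\<close> is governed by the sum of the three
  distances from an arbitrary compact space X to the \<open>A\<^sup>i\<close>. Twice the distances are, up to an error
  as small as desired, distortions \<open>e1, e2, e3\<close> of correspondences with X. If their sum is less than
  7, then the correspondence between \<open>A\<^sup>1\<close> and \<open>A\<^sup>2\<close> or \<open>A\<^sup>3\<close> composed through X has distortion
  less than 7, which is too small to do anything but match sides by size. So X has points
  \<open>x0, x1, x2\<close> related to the points 0, 1, 2 of all three spaces at once, and
  \<open>33 - e3 \<le> |x1 x2| \<le> |x0 x1| + |x0 x2| \<le> (8 + e1) + (18 + e2)\<close>,
  which forces \<open>e1 + e2 + e3 \<ge> 7\<close> after all (\<open>GH_tripod_ge\<close>). Equality holds for X(10, 20, 30), whose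
  distances to the \<open>A\<^sup>i\<close> are at most 1, 1 and 3/2; the star centred there is therefore a Steiner
  minimal tree, of length \<open>7/2 > 3\<close>.

  The conflict behind this is the triangle inequality: the triple (10, 20, 31) differs from each of
  the three given ones by at most 2 in every entry and would give a tripod of length 3, but
  \<open>10 + 20 < 31\<close>.
\<close>

section \<open>Connected graphs contain tripods\<close>

fun path_edges :: "'a list \<Rightarrow> 'a set set" where
  "path_edges (v # w # p) = insert {v, w} (path_edges (w # p))"
| "path_edges p = {}"

lemma path_edges_subset_Pow: "path_edges p \<subseteq> Pow (set p)"
  by (induction p rule: path_edges.induct) auto

lemma path_edges_meet_butlast: "e \<in> path_edges p \<Longrightarrow> e \<inter> set (butlast p) \<noteq> {}"
  by (induction p rule: path_edges.induct) auto

lemma finite_path_edges: "finite (path_edges p)"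
  by (induction p rule: path_edges.induct) auto

lemma path_edges_dropWhile: "path_edges (dropWhile P p) \<subseteq> path_edges p"
  by (induction p rule: path_edges.induct) auto

lemma last_dropWhile: "x \<in> set p \<Longrightarrow> \<not> P x \<Longrightarrow> last (dropWhile P p) = last p"
  by (induction p) (auto split: if_splits)

lemma set_butlast_dropWhile: "set (butlast (dropWhile P p)) \<subseteq> set (butlast p)"
  by (induction p) (auto split: if_splits)

lemma set_path_subset:
  assumes "p \<noteq> []" "hd p \<in> V" "path_edges p \<subseteq> Pow V"
  shows "set p \<subseteq> V"
  using assms by (induction p rule: path_edges.induct) auto

text \<open>
  A walk from c to P is cut short where it first meets P, and shortcut wherever it repeats a vertex.
\<close>

lemma path_to_set:
  assumes "(c, a) \<in> {(x, y). {x, y} \<in> E}\<^sup>*" "a \<in> P"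
  shows "\<exists>p. p \<noteq> [] \<and> distinct p \<and> hd p = c \<and> last p \<in> P \<and> path_edges p \<subseteq> E \<and>
    set (butlast p) \<inter> P = {}"
  using assms(1)
proof (induction rule: converse_rtrancl_induct)
  case base
  show ?case using assms(2) by (intro exI[of _ "[a]"]) auto
next
  case (step c y)
  then obtain q where q: "q \<noteq> []" "distinct q" "hd q = y" "last q \<in> P" "path_edges q \<subseteq> E"
    "set (butlast q) \<inter> P = {}" by blast
  consider "c \<in> P" | "c \<notin> P" "c \<in> set q" | "c \<notin> P" "c \<notin> set q" by blast
  then show ?case
  proof cases
    case 1
    then show ?thesis by (intro exI[of _ "[c]"]) auto
  next
    case 2
    let ?p = "dropWhile (\<lambda>v. v \<noteq> c) q"
    have ne: "?p \<noteq> []" using 2(2) by auto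
    moreover have "hd ?p = c" using hd_dropWhile[OF ne] by simp
    moreover have "last ?p = last q" using 2(2) by (intro last_dropWhile) auto
    moreover have "path_edges ?p \<subseteq> E" using path_edges_dropWhile q(5) by blast
    moreover have "set (butlast ?p) \<inter> P = {}" using set_butlast_dropWhile q(6) by fast
    ultimately show ?thesis using q by (intro exI[of _ ?p]) auto
  next
    case 3
    from q obtain q' where "q = y # q'" by (cases q) auto
    then show ?thesis using 3 q step(1) by (intro exI[of _ "c # q"]) auto
  qed
qed

lemma mdist_self: "x \<in> mspace X \<Longrightarrow> mdist X x x = 0"
  by simp

lemma path_length_ge:
  assumes "p \<noteq> []" "distinct p" "set p \<subseteq> mspace X" "x \<in> set p"
  shows "mdist X (hd p) x + mdist X x (last p) \<le> (\<Sum>e\<in>path_edges p. edge_length X e)"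
  using assms
proof (induction p arbitrary: x rule: path_edges.induct)
  case (1 v w p)
  have new: "{v, w} \<notin> path_edges (w # p)"
    using path_edges_subset_Pow[of "w # p"] 1(3) by auto
  have in_X: "v \<in> mspace X" "w \<in> mspace X" "x \<in> mspace X" "last (w # p) \<in> mspace X"
    using 1(4,5) last_in_set[of "w # p"] by auto
  have "\<exists>y\<in>set (w # p).
      mdist X v x + mdist X x (last (w # p)) \<le> mdist X v w + (mdist X w y + mdist X y (last (w # p)))"
  proof (cases "x = v")
    case True
    then show ?thesis
      using mdist_triangle[OF in_X(1,2,4)] in_X by (intro bexI[of _ w]) (simp_all add: mdist_self)
  next
    case False
    then show ?thesis
      using mdist_triangle[OF in_X(1,2,3)] 1(5) by (intro bexI[of _ x]) auto
  qed
  then obtain y where "y \<in> set (w # p)"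
    "mdist X v x + mdist X x (last (w # p)) \<le> mdist X v w + (mdist X w y + mdist X y (last (w # p)))"
    by blast
  moreover have "mdist X w y + mdist X y (last (w # p)) \<le> (\<Sum>e\<in>path_edges (w # p). edge_length X e)"
    using 1(1)[of y] 1(3,4) \<open>y \<in> _\<close> by simp
  ultimately show ?case
    using new finite_path_edges[of "w # p"] by simp
qed (auto simp: mdist_self)

text \<open>
  A path from c that stops where it first meets a path from a to b shares no edge with it, and
  the point x where it stops is the centre of the tripod.
\<close>

lemma connected_graph_tripod_le:
  assumes G: "graph_on X G" "connected_graph G" and abc: "{a, b, c} \<subseteq> fst G"
  obtains x where "x \<in> mspace X"
    "mdist X a x + mdist X b x + mdist X c x \<le> graph_length X G"
proof -
  have V: "finite (fst G)" "fst G \<subseteq> mspace X" and E: "snd G \<subseteq> Pow (fst G)"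
    using G(1) unfolding graph_on_def by blast+
  then have E_fin: "finite (snd G)" by (meson finite_Pow_iff finite_subset)
  obtain q where q: "q \<noteq> []" "distinct q" "hd q = a" "last q = b" "path_edges q \<subseteq> snd G"
    using path_to_set[of a b "snd G" "{b}"] G(2) abc unfolding connected_graph_def by blast
  obtain p where p: "p \<noteq> []" "distinct p" "hd p = c" "last p \<in> set q" "path_edges p \<subseteq> snd G"
    "set (butlast p) \<inter> set q = {}"
    using path_to_set[of c a "snd G" "set q"] G(2) abc q hd_in_set[OF q(1)]
    unfolding connected_graph_def by blast
  have hd: "hd q \<in> fst G" "hd p \<in> fst G" using q(3) p(3) abc by simp_all
  have pq: "set q \<subseteq> mspace X" "set p \<subseteq> mspace X"
    by (rule order_trans[OF set_path_subset[OF q(1) hd(1) order_trans[OF q(5) E]] V(2)]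
        order_trans[OF set_path_subset[OF p(1) hd(2) order_trans[OF p(5) E]] V(2)])+
  have disj: "path_edges q \<inter> path_edges p = {}"
    using path_edges_meet_butlast[of _ p] path_edges_subset_Pow[of q] p(6) by fast
  let ?x = "last p"
  have x: "?x \<in> mspace X" using pq p by auto
  have "mdist X a ?x + mdist X ?x b + mdist X c ?x
      \<le> (\<Sum>e\<in>path_edges q. edge_length X e) + (\<Sum>e\<in>path_edges p. edge_length X e)"
    using path_length_ge[OF q(1,2) pq(1) p(4)] path_length_ge[OF p(1,2) pq(2), of ?x]
    by (simp add: p(1,3) q(3,4) mdist_self[OF x])
  also have "\<dots> = (\<Sum>e\<in>path_edges q \<union> path_edges p. edge_length X e)"
    using disj by (simp add: sum.union_disjoint finite_path_edges)
  also have "\<dots> \<le> graph_length X G"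
    unfolding graph_length_def
    by (rule sum_mono2) (use E_fin p q edge_length_nonneg[OF G(1)] in auto)
  finally show thesis using that[OF x] by (simp add: mdist_commute)
qed


section \<open>Stars and cones\<close>

definition star_graph :: "'a \<Rightarrow> 'a set \<Rightarrow> 'a graph" where
  "star_graph c P = (insert c P, (\<lambda>v. {v, c}) ` (P - {c}))"

lemma graph_on_star:
  assumes "finite P" "P \<subseteq> mspace X" "c \<in> mspace X"
  shows "graph_on X (star_graph c P)"
  using assms unfolding graph_on_def star_graph_def by auto

lemma tree_graph_star: "tree_graph (star_graph c P)"
  unfolding tree_graph_def
proof
  let ?R = "{(x, y). {x, y} \<in> snd (star_graph c P)}"
  have to: "(v, c) \<in> ?R\<^sup>*" if "v \<in> insert c P" for v
    using that by (cases "v = c") (auto simp: star_graph_def)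
  have "sym ?R" by (auto simp: sym_def insert_commute)
  then have "(c, v) \<in> ?R\<^sup>*" if "v \<in> insert c P" for v
    using to[OF that] sym_rtrancl symD by metis
  with to show "connected_graph (star_graph c P)"
    unfolding connected_graph_def by (auto simp: star_graph_def intro: rtrancl_trans)
  show "\<not> (\<exists>vs. graph_cycle (star_graph c P) vs)"
  proof
    assume "\<exists>vs. graph_cycle (star_graph c P) vs"
    then obtain vs where n: "3 \<le> length vs" "distinct vs"
      and e: "\<And>i. i < length vs \<Longrightarrow> {vs ! i, vs ! (Suc i mod length vs)} \<in> snd (star_graph c P)"
      unfolding graph_cycle_def by blast
    \<comment> \<open>Every edge contains c, but no vertex lies on the three edges starting at positions 0, 1, 2.\<close>
    have c: "c = vs ! i \<or> c = vs ! (Suc i mod length vs)" if "i < length vs" for i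
      using e[OF that] by (auto simp: star_graph_def doubleton_eq_iff)
    have "3 mod length vs \<noteq> 1"
      using n(1) by (cases "length vs = 3") auto
    moreover have "3 mod length vs < length vs" using n(1) by (intro mod_less_divisor) auto
    ultimately have "vs ! (3 mod length vs) \<noteq> vs ! 1"
      using n by (subst nth_eq_iff_index_eq) auto
    moreover have "vs ! 0 \<noteq> vs ! 1" "vs ! 0 \<noteq> vs ! 2" "vs ! 1 \<noteq> vs ! 2"
      using n by (subst nth_eq_iff_index_eq; auto)+
    moreover have "c = vs ! 0 \<or> c = vs ! 1" "c = vs ! 1 \<or> c = vs ! 2"
      "c = vs ! 2 \<or> c = vs ! (3 mod length vs)"
    proof -
      have "Suc 0 mod length vs = 1" "Suc 1 mod length vs = 2" using n(1) by simp_all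
      moreover have "0 < length vs" "1 < length vs" "2 < length vs" using n(1) by linarith+
      ultimately show "c = vs ! 0 \<or> c = vs ! 1" "c = vs ! 1 \<or> c = vs ! 2"
        "c = vs ! 2 \<or> c = vs ! (3 mod length vs)"
        using c[of 0] c[of 1] c[of 2] by (simp_all add: eval_nat_numeral)
    qed
    ultimately show False by metis
  qed
qed

lemma graph_length_star:
  assumes "finite P" "P \<subseteq> mspace X" "c \<in> mspace X"
  shows "graph_length X (star_graph c P) = (\<Sum>v\<in>P. mdist X v c)"
proof -
  have "inj_on (\<lambda>v. {v, c}) (P - {c})" by (auto simp: inj_on_def doubleton_eq_iff)
  then have "graph_length X (star_graph c P) = (\<Sum>v\<in>P - {c}. mdist X v c)"
    unfolding graph_length_def star_graph_def by (simp add: sum.reindex)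
  also have "\<dots> = (\<Sum>v\<in>P. mdist X v c)"
    using assms by (intro sum.mono_neutral_left) auto
  finally show ?thesis .
qed

lemma mf_nonneg:
  fixes M :: "'a metric"
  assumes fin: "finite (mspace M)"
  shows "0 \<le> mf M"
  unfolding mf_def
proof (rule cInf_greatest)
  have "inj_on (real \<circ> to_nat_on (mspace M)) (mspace M)"
    using fin by (intro comp_inj_on inj_on_to_nat_on countable_finite) (auto simp: inj_on_def)
  then obtain Y :: "real metric" where "isometric_embedding M Y (real \<circ> to_nat_on (mspace M))"
    using transport_metric by blast
  then show "{r. \<exists>(X :: real metric) \<mu>. isometric_embedding M X \<mu> \<and> smt (\<mu> ` mspace M) X \<le> r} \<noteq> {}"
    by blast
next
  fix r assume "r \<in> {r. \<exists>(X :: real metric) \<mu>. isometric_embedding M X \<mu> \<and> smt (\<mu> ` mspace M) X \<le> r}"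
  then obtain X :: "real metric" and \<mu>
    where X: "isometric_embedding M X \<mu>" "smt (\<mu> ` mspace M) X \<le> r" by blast
  have "0 \<le> smt (\<mu> ` mspace M) X"
    by (rule smt_nonneg) (use X fin in \<open>auto simp: isometric_embedding_def\<close>)
  with X show "0 \<le> r" by linarith
qed

text \<open>
  A point at distance r from all points of M may be added exactly when M has diameter at most 2 r;
  the star centred at that point has one edge of length r for each point of M.
\<close>

lemma mf_le_cone:
  fixes M :: "'a metric"
  assumes fin: "finite (mspace M)" and r: "0 < r"
    and diam: "\<And>x y. x \<in> mspace M \<Longrightarrow> y \<in> mspace M \<Longrightarrow> mdist M x y \<le> 2 * r"
  shows "mf M \<le> real (card (mspace M)) * r"
proof -
  define d where "d p q = (case p of
      None \<Rightarrow> (case q of None \<Rightarrow> 0 | Some y \<Rightarrow> r)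
    | Some x \<Rightarrow> (case q of None \<Rightarrow> r | Some y \<Rightarrow> mdist M x y))" for p q
  let ?C = "insert None (Some ` mspace M)"
  have MC: "Metric_space ?C d"
  proof
    show "0 \<le> d p q" "d p q = d q p" for p q
      using r by (auto simp: d_def mdist_commute split: option.split)
    show "d p q = 0 \<longleftrightarrow> p = q" if "p \<in> ?C" "q \<in> ?C" for p q
      using that r by (auto simp: d_def)
    show "d p s \<le> d p q + d q s" if "p \<in> ?C" "q \<in> ?C" "s \<in> ?C" for p q s
      using that r diam by (auto simp: d_def mdist_triangle)
  qed
  let ?X = "metric (?C, d)"
  have X: "mspace ?X = ?C" "mdist ?X = d"
    using Metric_space.mspace_metric[OF MC] Metric_space.mdist_metric[OF MC] by auto
  have emb: "isometric_embedding M ?X Some"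
    unfolding isometric_embedding_def X by (auto simp: d_def)
  let ?G = "star_graph None (Some ` mspace M)"
  have "mf M \<le> smt (Some ` mspace M) ?X" by (rule mf_le[OF fin emb])
  also have "\<dots> \<le> graph_length ?X ?G"
  proof (rule smt_le)
    show "graph_on ?X ?G" using fin by (intro graph_on_star) (auto simp: X)
    show "connected_graph ?G"
      using tree_graph_star[of None "Some ` mspace M"] unfolding tree_graph_def by blast
    show "Some ` mspace M \<subseteq> fst ?G" by (auto simp: star_graph_def)
  qed
  also have "\<dots> = (\<Sum>v\<in>Some ` mspace M. mdist ?X v None)"
    using fin by (intro graph_length_star) (auto simp: X)
  also have "\<dots> = real (card (mspace M)) * r"
    by (simp add: sum.reindex X d_def)
  finally show ?thesis .
qed


section \<open>Gromov--Hausdorff distances of three-point spaces\<close>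

lemma GH_dist_three_point_le:
  assumes abc: "0 < a" "0 < b" "0 < c" "a \<le> b + c" "b \<le> a + c" "c \<le> a + b"
    and abc': "0 < a'" "0 < b'" "0 < c'" "a' \<le> b' + c'" "b' \<le> a' + c'" "c' \<le> a' + b'"
    and "0 < r" "\<bar>a - a'\<bar> \<le> 2 * r" "\<bar>b - b'\<bar> \<le> 2 * r" "\<bar>c - c'\<bar> \<le> 2 * r"
  shows "GH_dist (three_point_space a b c) (three_point_space a' b' c') \<le> r"
proof (rule GH_dist_le_of_correspondence)
  show "compact_metric (three_point_space a b c)" "compact_metric (three_point_space a' b' c')"
    by (rule compact_metric_three_point[OF abc] compact_metric_three_point[OF abc'])+
  show "correspondence (three_point_space a b c) (three_point_space a' b' c')
      {(0, 0), (1, 1), (2, 2)} (2 * r)"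
    using assms(13-16)
    by (intro correspondenceI)
      (auto simp: three_point_space_simps[OF abc] three_point_space_simps[OF abc']
        three_point_dist_def doubleton_eq_iff)
qed (use assms in simp)

lemma GH_tripod_ge:
  fixes X :: "'a metric"
  assumes X: "compact_metric X"
  shows "7 / 2 \<le> GH_dist (three_point_space 8 22 29.5) X + GH_dist (three_point_space 11.5 18 29) X
    + GH_dist (three_point_space 12 21.5 33) X" (is "_ \<le> ?d1 + ?d2 + ?d3")
proof (rule ccontr)
  let ?B1 = "three_point_space 8 22 29.5" and ?B2 = "three_point_space 11.5 18 29"
    and ?B3 = "three_point_space 12 21.5 33"
  have B: "mspace ?B1 = {0, 1, 2}" "mspace ?B2 = {0, 1, 2}" "mspace ?B3 = {0, 1, 2}"
    and d: "mdist ?B1 = three_point_dist 8 22 29.5" "mdist ?B2 = three_point_dist 11.5 18 29"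
      "mdist ?B3 = three_point_dist 12 21.5 33"
    by (simp_all add: three_point_space_simps)
  have c: "compact_metric ?B1" "compact_metric ?B2" "compact_metric ?B3"
    by (simp_all add: compact_metric_three_point)
  define g1 g2 g3 where g_def: "g1 = ?d1" "g2 = ?d2" "g3 = ?d3"
  assume "\<not> ?thesis"
  then have lt: "g1 + g2 + g3 < 7 / 2" unfolding g_def by simp
  define t where "t = (7 / 2 - (g1 + g2 + g3)) / 4"
  have t: "0 < t" using lt by (simp add: t_def)
  obtain R1 where R1: "correspondence ?B1 X R1 (2 * (g1 + t))"
    using GH_dist_less_imp_correspondence[OF c(1) X, of "g1 + t"] t unfolding g_def by auto
  obtain R2 where R2: "correspondence ?B2 X R2 (2 * (g2 + t))"
    using GH_dist_less_imp_correspondence[OF c(2) X, of "g2 + t"] t unfolding g_def by auto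
  obtain R3 where R3: "correspondence ?B3 X R3 (2 * (g3 + t))"
    using GH_dist_less_imp_correspondence[OF c(3) X, of "g3 + t"] t unfolding g_def by auto
  define e1 e2 e3 where e_def: "e1 = 2 * (g1 + t)" "e2 = 2 * (g2 + t)" "e3 = 2 * (g3 + t)"
  have "0 \<le> g1" "0 \<le> g2" "0 \<le> g3"
    unfolding g_def by (rule GH_dist_nonneg c X)+
  then have e: "0 \<le> e1" "0 \<le> e2" "0 \<le> e3" using t by (simp_all add: e_def)
  have "4 * t = 7 / 2 - (g1 + g2 + g3)" by (simp add: t_def)
  then have sum: "e1 + e2 + e3 < 7" using t unfolding e_def by (simp add: algebra_simps)
  note R = R1[folded e_def] R2[folded e_def] R3[folded e_def]
  obtain x0 x1 x2 where x: "(0, x0) \<in> R1" "(1, x1) \<in> R1" "(2, x2) \<in> R1"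
    using correspondenceD(3)[OF R(1), of 0] correspondenceD(3)[OF R(1), of 1]
      correspondenceD(3)[OF R(1), of 2] unfolding B by auto
  then have xX: "x0 \<in> mspace X" "x1 \<in> mspace X" "x2 \<in> mspace X"
    using correspondenceD(2)[OF R(1)] by blast+
  obtain q0 q1 q2 where q: "(q0, x0) \<in> R2" "(q1, x1) \<in> R2" "(q2, x2) \<in> R2"
    using correspondenceD(4)[OF R(2)] xX by meson
  obtain r0 r1 r2 where r: "(r0, x0) \<in> R3" "(r1, x1) \<in> R3" "(r2, x2) \<in> R3"
    using correspondenceD(4)[OF R(3)] xX by meson
  note qB = q[THEN correspondenceD(1)[OF R(2)], unfolded B]
    and rB = r[THEN correspondenceD(1)[OF R(3)], unfolded B]
  have d1: "\<bar>8 - mdist X x0 x1\<bar> \<le> e1" "\<bar>22 - mdist X x0 x2\<bar> \<le> e1" "\<bar>29.5 - mdist X x1 x2\<bar> \<le> e1"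
    using correspondenceD(5)[OF R(1) x(1,2)] correspondenceD(5)[OF R(1) x(1,3)]
      correspondenceD(5)[OF R(1) x(2,3)]
    unfolding d three_point_dist_def by (simp_all add: doubleton_eq_iff)
  note d2 = correspondenceD(5)[OF R(2) q(1,2)] correspondenceD(5)[OF R(2) q(1,3)]
    correspondenceD(5)[OF R(2) q(2,3)]
  note d3 = correspondenceD(5)[OF R(3) r(1,2)] correspondenceD(5)[OF R(3) r(1,3)]
    correspondenceD(5)[OF R(3) r(2,3)]
  \<comment> \<open>The third distortion is nonnegative, so each composed distortion stays below 7. This
    leaves one possible partner for each side: the sides 0, 18, 29 of the second space are too far
    from 8, the sides 0, 11.5, 29 from 22, and the sides 0, 11.5, 18 from 29.5. The value 7 is just
    excluded for the pair 22 and 29.\<close>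
  have "\<bar>8 - mdist ?B2 q0 q1\<bar> < 7" "\<bar>22 - mdist ?B2 q0 q2\<bar> < 7" "\<bar>29.5 - mdist ?B2 q1 q2\<bar> < 7"
    using d1 d2 e sum by linarith+
  then have q_eq: "q0 = 0 \<and> q1 = 1 \<and> q2 = 2"
    using qB unfolding d three_point_dist_def by (auto simp: doubleton_eq_iff)
  have "\<bar>8 - mdist ?B3 r0 r1\<bar> < 7" "\<bar>22 - mdist ?B3 r0 r2\<bar> < 7" "\<bar>29.5 - mdist ?B3 r1 r2\<bar> < 7"
    using d1 d3 e sum by linarith+
  then have r_eq: "r0 = 0 \<and> r1 = 1 \<and> r2 = 2"
    using rB unfolding d three_point_dist_def by (auto simp: doubleton_eq_iff)
  have "mdist X x0 x2 \<le> 18 + e2" "33 - e3 \<le> mdist X x1 x2"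
    using d2 d3 q_eq r_eq unfolding d three_point_dist_def by (auto simp: doubleton_eq_iff)
  moreover have "mdist X x1 x2 \<le> mdist X x0 x1 + mdist X x0 x2"
    using mdist_triangle[OF xX(2,1,3)] by (simp add: mdist_commute)
  ultimately show False using d1(1) sum by linarith
qed


section \<open>The Steiner minimal tree and the minimal filling\<close>

theorem corollary3p8:
  fixes A1 A2 A3 :: "real metric set" and M :: "real metric set set"
  assumes "A1 = isometry_class (three_point_space 8 22 29.5)"
    and "A2 = isometry_class (three_point_space 11.5 18 29)"
    and "A3 = isometry_class (three_point_space 12 21.5 33)"
    and "M = {A1, A2, A3}"
  shows "SMT M GH_space \<noteq> {} \<and>
    (\<forall>G\<in>SMT M GH_space. \<not> minimal_filling G M GH_space) \<and>
    smt M GH_space > mf (submetric GH_space M) \<and>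
    ssr GH_space < 1"
proof -
  let ?d = "mdist GH_space"
  have c: "compact_metric (three_point_space 8 22 29.5)" "compact_metric (three_point_space 11.5 18 29)"
    "compact_metric (three_point_space 12 21.5 33)" "compact_metric (three_point_space 10 20 30)"
    by (simp_all add: compact_metric_three_point)
  define S :: "real metric set" where "S = isometry_class (three_point_space 10 20 30)"
  have A: "A1 \<in> mspace GH_space" "A2 \<in> mspace GH_space" "A3 \<in> mspace GH_space"
    and S: "S \<in> mspace GH_space"
    unfolding assms(1-3) S_def by (rule isometry_class_in_GH c)+
  have AA: "?d A1 A2 \<le> 2" "?d A1 A3 \<le> 2" "?d A2 A3 \<le> 2"
    and AS: "?d A1 S \<le> 1" "?d A2 S \<le> 1" "?d A3 S \<le> 3 / 2"
    unfolding assms(1-3) S_def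
    by (simp_all only: mdist_GH_space_class c) (rule GH_dist_three_point_le; simp)+
  note AA_sym = AA[unfolded mdist_commute[of GH_space A1 A2] mdist_commute[of GH_space A1 A3]
      mdist_commute[of GH_space A2 A3]]
  have AA0: "?d A1 A1 = 0" "?d A2 A2 = 0" "?d A3 A3 = 0"
    by (rule mdist_self A)+
  have tripod: "7 / 2 \<le> ?d A1 X + ?d A2 X + ?d A3 X" if "X \<in> mspace GH_space" for X
  proof -
    from that obtain Y :: "real metric" where "compact_metric Y" "X = isometry_class Y"
      using isometry_classesE by auto
    then show ?thesis
      unfolding assms(1-3) using GH_tripod_ge by (simp only: mdist_GH_space_class c)
  qed
  \<comment> \<open>If two of the three points coincided, the tripod centred there would have length at most 2.\<close>
  have ne: "A1 \<noteq> A2" "A1 \<noteq> A3" "A2 \<noteq> A3"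
    using tripod[OF A(1)] tripod[OF A(2)] AA AA0 AA_sym by (auto simp del: mdist_GH_space)
  have M: "finite M" "M \<subseteq> mspace GH_space" "card M = 3" using A ne by (auto simp: assms(4))
  have lower: "7 / 2 \<le> graph_length GH_space G"
    if H: "graph_on GH_space G" "connected_graph G" "M \<subseteq> fst G" for G
  proof -
    have "{A1, A2, A3} \<subseteq> fst G" using H(3) by (simp only: assms(4))
    then obtain X where "X \<in> mspace GH_space" "?d A1 X + ?d A2 X + ?d A3 X \<le> graph_length GH_space G"
      by (rule connected_graph_tripod_le[OF H(1,2)])
    with tripod[of X] show ?thesis by linarith
  qed
  then have smt_ge: "7 / 2 \<le> smt M GH_space"
    unfolding smt_def by (intro cInf_greatest[OF smt_set_nonempty[OF M(1,2)]]) blast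
  let ?G = "star_graph S M"
  have G: "graph_on GH_space ?G" "tree_graph ?G" "M \<subseteq> fst ?G"
    using graph_on_star[OF M(1,2) S] tree_graph_star by (auto simp: star_graph_def)
  have "graph_length GH_space ?G \<le> 7 / 2"
    unfolding graph_length_star[OF M(1,2) S] using ne AS by (simp add: assms(4) del: mdist_GH_space)
  moreover have "smt M GH_space \<le> graph_length GH_space ?G"
    using G by (intro smt_le) (auto simp: tree_graph_def)
  ultimately have SMT: "?G \<in> SMT M GH_space"
    using smt_ge G by (auto simp: SMT_def)
  have sub: "mspace (submetric GH_space M) = M" using M by auto
  have "?d x y \<le> 2" if "x \<in> M" "y \<in> M" for x y
    using that AA AA0 AA_sym by (auto simp: assms(4) simp del: mdist_GH_space)
  then have "mf (submetric GH_space M) \<le> real (card M) * 1"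
    using mf_le_cone[of "submetric GH_space M" 1] M(1) unfolding sub by simp
  then have less: "mf (submetric GH_space M) < smt M GH_space" using smt_ge M by simp
  then have "\<not> minimal_filling G M GH_space" if "G \<in> SMT M GH_space" for G
    using that by (auto simp: minimal_filling_def SMT_def)
  moreover have "ssr GH_space < 1"
  proof -
    have "ssr GH_space \<le> mf (submetric GH_space M) / smt M GH_space"
      unfolding ssr_def
    proof (rule cInf_lower)
      show "bdd_below {mf (submetric GH_space N) / smt N GH_space | N.
          N \<subseteq> mspace GH_space \<and> finite N \<and> 2 \<le> card N}"
      proof (rule bdd_belowI)
        fix q assume "q \<in> {mf (submetric GH_space N) / smt N GH_space | N.
          N \<subseteq> mspace GH_space \<and> finite N \<and> 2 \<le> card N}"
        then obtain N where N: "q = mf (submetric GH_space N) / smt N GH_space"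
          "N \<subseteq> mspace GH_space" "finite N" by blast
        then have "0 \<le> mf (submetric GH_space N)" by (intro mf_nonneg) simp
        with N show "0 \<le> q" by (simp only: divide_nonneg_nonneg smt_nonneg)
      qed
      show "mf (submetric GH_space M) / smt M GH_space \<in> {mf (submetric GH_space N) / smt N GH_space | N.
          N \<subseteq> mspace GH_space \<and> finite N \<and> 2 \<le> card N}"
        using M by (intro CollectI exI[of _ M]) simp
    qed
    also have "\<dots> < 1" using less smt_ge by simp
    finally show ?thesis .
  qed
  ultimately show ?thesis using SMT less by blast
qed

end
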